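(* For every small category $\mathcal A$, the category $\mathbf{CrsGrp}_{\mathcal A}$ of crossed $\mathcal A$-groups is both complete and cocomplete. In particular, it admits a terminal object.
   Context: Let $\mathcal A$ be a small category. An $\mathcal A$-set is a presheaf of sets on $\mathcal A$. A crossed $\mathcal A$-group is an $\mathcal A$-set $G$ together with a group structure on $G(a)$ for each $a\in\mathcal A$ and a left action $G(b)\times\mathcal A(a,b)\to\mathcal A(a,b)$, $(x,\varphi)\mapsto\varphi^x$, of the group $G(b)$ on the set $\mathcal A(a,b)$ for all $a,b\in\mathcal A$, such that: (i) for $\varphi:a\to b$, $\psi:b\to c$ in $\mathcal A$ and $x\in G(c)$, $(\psi\varphi)^x=\psi^x\varphi^{\psi^\ast(x)}$; (ii) for $\varphi:a\to b$ in $\mathcal A$ and $x,y\in G(b)$, $\varphi^\ast(xy)=(\varphi^y)^\ast(x)\,\varphi^\ast(y)$. Here $\varphi^\ast:G(b)\to G(a)$ is the presheaf structure map. A map of crossed $\mathcal A$-groups is a map of $\mathcal A$-sets which is degreewise a group homomorphism and respects the actions on the sets $\mathcal A(a,b)$. These form the category $\mathbf{CrsGrp}_{\mathcal A}$. Complete and cocomplete refer to small limits and colimits. *)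

theory Defs
  imports "HOL-Algebra.Group_Action" "HOL-Library.Equipollence" "HOL-Library.FuncSet"
begin

section \<open>Categories, functors and limits\<close>

record ('o, 'm) cat =
  Obj :: "'o set"
  Arr :: "'m set"
  Dom :: "'m \<Rightarrow> 'o"
  Cod :: "'m \<Rightarrow> 'o"
  Idn :: "'o \<Rightarrow> 'm"
  Cmp :: "'m \<Rightarrow> 'm \<Rightarrow> 'm"

text \<open>Composition is written in the usual order: \<^term>\<open>Cmp C g f\<close> is $g \circ f$.\<close>

definition arrows :: "('o, 'm) cat \<Rightarrow> 'o \<Rightarrow> 'o \<Rightarrow> 'm set" where
  "arrows C a b = {f \<in> Arr C. Dom C f = a \<and> Cod C f = b}"

locale category =
  fixes C :: "('o, 'm) cat"
  assumes Dom_in: "f \<in> Arr C \<Longrightarrow> Dom C f \<in> Obj C"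
    and Cod_in: "f \<in> Arr C \<Longrightarrow> Cod C f \<in> Obj C"
    and Idn_in: "a \<in> Obj C \<Longrightarrow> Idn C a \<in> arrows C a a"
    and Cmp_in: "\<lbrakk>f \<in> arrows C a b; g \<in> arrows C b c\<rbrakk> \<Longrightarrow> Cmp C g f \<in> arrows C a c"
    and Cmp_Idn: "f \<in> arrows C a b \<Longrightarrow> Cmp C f (Idn C a) = f"
    and Idn_Cmp: "f \<in> arrows C a b \<Longrightarrow> Cmp C (Idn C b) f = f"
    and Cmp_assoc: "\<lbrakk>f \<in> arrows C a b; g \<in> arrows C b c; h \<in> arrows C c d\<rbrakk>
      \<Longrightarrow> Cmp C h (Cmp C g f) = Cmp C (Cmp C h g) f"

locale is_functor = J: category J + C: category C
  for J :: "('i, 'j) cat" and C :: "('o, 'm) cat" +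
  fixes F\<^sub>o :: "'i \<Rightarrow> 'o" and F\<^sub>a :: "'j \<Rightarrow> 'm"
  assumes Obj_map: "i \<in> Obj J \<Longrightarrow> F\<^sub>o i \<in> Obj C"
    and Arr_map: "u \<in> arrows J i k \<Longrightarrow> F\<^sub>a u \<in> arrows C (F\<^sub>o i) (F\<^sub>o k)"
    and Idn_map: "i \<in> Obj J \<Longrightarrow> F\<^sub>a (Idn J i) = Idn C (F\<^sub>o i)"
    and Cmp_map: "\<lbrakk>u \<in> arrows J i k; v \<in> arrows J k l\<rbrakk>
      \<Longrightarrow> F\<^sub>a (Cmp J v u) = Cmp C (F\<^sub>a v) (F\<^sub>a u)"

definition is_cone ::
  "('i, 'j) cat \<Rightarrow> ('o, 'm) cat \<Rightarrow> ('i \<Rightarrow> 'o) \<Rightarrow> ('j \<Rightarrow> 'm) \<Rightarrow> 'o \<Rightarrow> ('i \<Rightarrow> 'm) \<Rightarrow> bool" where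
  "is_cone J C F\<^sub>o F\<^sub>a L p \<longleftrightarrow> L \<in> Obj C \<and>
     (\<forall>i\<in>Obj J. p i \<in> arrows C L (F\<^sub>o i)) \<and>
     (\<forall>u\<in>Arr J. Cmp C (F\<^sub>a u) (p (Dom J u)) = p (Cod J u))"

definition is_limit ::
  "('i, 'j) cat \<Rightarrow> ('o, 'm) cat \<Rightarrow> ('i \<Rightarrow> 'o) \<Rightarrow> ('j \<Rightarrow> 'm) \<Rightarrow> 'o \<Rightarrow> ('i \<Rightarrow> 'm) \<Rightarrow> bool" where
  "is_limit J C F\<^sub>o F\<^sub>a L p \<longleftrightarrow> is_cone J C F\<^sub>o F\<^sub>a L p \<and>
     (\<forall>M q. is_cone J C F\<^sub>o F\<^sub>a M q \<longrightarrow>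
        (\<exists>!h. h \<in> arrows C M L \<and> (\<forall>i\<in>Obj J. Cmp C (p i) h = q i)))"

definition is_cocone ::
  "('i, 'j) cat \<Rightarrow> ('o, 'm) cat \<Rightarrow> ('i \<Rightarrow> 'o) \<Rightarrow> ('j \<Rightarrow> 'm) \<Rightarrow> 'o \<Rightarrow> ('i \<Rightarrow> 'm) \<Rightarrow> bool" where
  "is_cocone J C F\<^sub>o F\<^sub>a L p \<longleftrightarrow> L \<in> Obj C \<and>
     (\<forall>i\<in>Obj J. p i \<in> arrows C (F\<^sub>o i) L) \<and>
     (\<forall>u\<in>Arr J. Cmp C (p (Cod J u)) (F\<^sub>a u) = p (Dom J u))"

definition is_colimit ::
  "('i, 'j) cat \<Rightarrow> ('o, 'm) cat \<Rightarrow> ('i \<Rightarrow> 'o) \<Rightarrow> ('j \<Rightarrow> 'm) \<Rightarrow> 'o \<Rightarrow> ('i \<Rightarrow> 'm) \<Rightarrow> bool" where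
  "is_colimit J C F\<^sub>o F\<^sub>a L p \<longleftrightarrow> is_cocone J C F\<^sub>o F\<^sub>a L p \<and>
     (\<forall>M q. is_cocone J C F\<^sub>o F\<^sub>a M q \<longrightarrow>
        (\<exists>!h. h \<in> arrows C L M \<and> (\<forall>i\<in>Obj J. Cmp C h (p i) = q i)))"

definition is_terminal :: "('o, 'm) cat \<Rightarrow> 'o \<Rightarrow> bool" where
  "is_terminal C T \<longleftrightarrow> T \<in> Obj C \<and> (\<forall>X\<in>Obj C. \<exists>!h. h \<in> arrows C X T)"

section \<open>Sizes\<close>

text \<open>
  The sets of the theory are the subsets of a type \<^typ>\<open>'u\<close> singled out by the predicate
  \<open>sets\<close>; the predicate \<open>small\<close> bounds the categories \<open>\<A>\<close> and the shapes of limits and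
  colimits. In a Grothendieck universe both predicates are "of cardinality below \<open>\<kappa>\<close>", with
  \<open>\<kappa>\<close> strongly inaccessible and uncountable. As HOL proves no such \<open>\<kappa>\<close> to exist, only
  the closure properties below are demanded: they hold in a Grothendieck universe, and also for
  \<open>small\<close> = "at most as many elements as a given infinite type \<^typ>\<open>'i\<close>" and arbitrary
  subsets of \<^typ>\<open>'i \<Rightarrow> bool\<close> as sets (lemma \<open>size_universe_fun\<close>).
\<close>

locale size_universe =
  fixes small sets :: "'u set \<Rightarrow> bool"
  assumes small_lepoll: "\<lbrakk>small X; Y \<lesssim> X\<rbrakk> \<Longrightarrow> small Y"
    and sets_lepoll: "\<lbrakk>sets X; Y \<lesssim> X\<rbrakk> \<Longrightarrow> sets Y"
    and small_sets: "small X \<Longrightarrow> sets X"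
    and small_infinite: "\<exists>X. small X \<and> infinite X"
    and sets_Sigma: "\<lbrakk>small I; \<And>i. i \<in> I \<Longrightarrow> sets (S i)\<rbrakk>
      \<Longrightarrow> \<exists>Y. sets Y \<and> Y \<approx> Sigma I S"
    and sets_PiE: "\<lbrakk>small I; \<And>i. i \<in> I \<Longrightarrow> sets (S i)\<rbrakk>
      \<Longrightarrow> \<exists>Y. sets Y \<and> Y \<approx> Pi\<^sub>E I S"

definition small_category :: "('u set \<Rightarrow> bool) \<Rightarrow> ('u, 'u) cat \<Rightarrow> bool" where
  "small_category small C \<longleftrightarrow> category C \<and> small (Obj C) \<and> small (Arr C)"

definition small_complete :: "('u set \<Rightarrow> bool) \<Rightarrow> ('o, 'm) cat \<Rightarrow> bool" where
  "small_complete small C \<longleftrightarrow>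
     (\<forall>J F\<^sub>o F\<^sub>a. small_category small J \<and> is_functor J C F\<^sub>o F\<^sub>a \<longrightarrow> (\<exists>L p. is_limit J C F\<^sub>o F\<^sub>a L p))"

definition small_cocomplete :: "('u set \<Rightarrow> bool) \<Rightarrow> ('o, 'm) cat \<Rightarrow> bool" where
  "small_cocomplete small C \<longleftrightarrow>
     (\<forall>J F\<^sub>o F\<^sub>a. small_category small J \<and> is_functor J C F\<^sub>o F\<^sub>a \<longrightarrow> (\<exists>L p. is_colimit J C F\<^sub>o F\<^sub>a L p))"

section \<open>Crossed groups\<close>

locale presheaf = category A
  for A :: "('o, 'm) cat" and X :: "'o \<Rightarrow> 'x set" and r :: "'m \<Rightarrow> 'x \<Rightarrow> 'x" +
  assumes res_in: "\<lbrakk>\<phi> \<in> arrows A a b; x \<in> X b\<rbrakk> \<Longrightarrow> r \<phi> x \<in> X a"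
    and res_Idn: "\<lbrakk>a \<in> Obj A; x \<in> X a\<rbrakk> \<Longrightarrow> r (Idn A a) x = x"
    and res_Cmp: "\<lbrakk>\<phi> \<in> arrows A a b; \<psi> \<in> arrows A b c; x \<in> X c\<rbrakk>
      \<Longrightarrow> r (Cmp A \<psi> \<phi>) x = r \<phi> (r \<psi> x)"

text \<open>
  \<^term>\<open>res G \<phi>\<close> is $\varphi^*$ and \<^term>\<open>act G a b x \<phi>\<close> is $\varphi^x$ for
  $\varphi : a \to b$ and $x \in G(b)$.
\<close>

record ('o, 'm, 'x) crossed =
  grp :: "'o \<Rightarrow> 'x monoid"
  res :: "'m \<Rightarrow> 'x \<Rightarrow> 'x"
  act :: "'o \<Rightarrow> 'o \<Rightarrow> 'x \<Rightarrow> 'm \<Rightarrow> 'm"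

locale crossed_group = presheaf A "\<lambda>a. carrier (grp G a)" "res G"
  for A :: "('o, 'm) cat" and G :: "('o, 'm, 'x) crossed" +
  assumes group_grp: "a \<in> Obj A \<Longrightarrow> group (grp G a)"
    and action: "\<lbrakk>a \<in> Obj A; b \<in> Obj A\<rbrakk> \<Longrightarrow> group_action (grp G b) (arrows A a b) (act G a b)"
    and act_Cmp: "\<lbrakk>\<phi> \<in> arrows A a b; \<psi> \<in> arrows A b c; x \<in> carrier (grp G c)\<rbrakk>
      \<Longrightarrow> act G a c x (Cmp A \<psi> \<phi>) = Cmp A (act G b c x \<psi>) (act G a b (res G \<psi> x) \<phi>)"
    and res_mult: "\<lbrakk>\<phi> \<in> arrows A a b; x \<in> carrier (grp G b); y \<in> carrier (grp G b)\<rbrakk>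
      \<Longrightarrow> res G \<phi> (x \<otimes>\<^bsub>grp G b\<^esub> y) = res G (act G a b y \<phi>) x \<otimes>\<^bsub>grp G a\<^esub> res G \<phi> y"

text \<open>
  Maps are extensional functions, so that two maps are equal as soon as they agree on all
  elements of all \<open>G(a)\<close>.
\<close>

definition crossed_maps ::
  "('o, 'm) cat \<Rightarrow> ('o, 'm, 'x) crossed \<Rightarrow> ('o, 'm, 'x) crossed \<Rightarrow> ('o \<Rightarrow> 'x \<Rightarrow> 'x) set" where
  "crossed_maps A G H =
     {\<alpha> \<in> (\<Pi>\<^sub>E a\<in>Obj A. carrier (grp G a) \<rightarrow>\<^sub>E carrier (grp H a)).
        (\<forall>a\<in>Obj A. \<alpha> a \<in> hom (grp G a) (grp H a)) \<and>
        (\<forall>a b. \<forall>\<phi>\<in>arrows A a b. \<forall>x\<in>carrier (grp G b). \<alpha> a (res G \<phi> x) = res H \<phi> (\<alpha> b x)) \<and>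
        (\<forall>a b. \<forall>\<phi>\<in>arrows A a b. \<forall>x\<in>carrier (grp G b). act G a b x \<phi> = act H a b (\<alpha> b x) \<phi>)}"

text \<open>
  Objects are not normalised outside their carriers: two crossed groups with the same data on
  carriers may differ as objects, but are then isomorphic by the identity function. Arrows carry
  their source and target.
\<close>

definition CrsGrp :: "('x set \<Rightarrow> bool) \<Rightarrow> ('o, 'm) cat \<Rightarrow>
    (('o, 'm, 'x) crossed, ('o, 'm, 'x) crossed \<times> ('o \<Rightarrow> 'x \<Rightarrow> 'x) \<times> ('o, 'm, 'x) crossed) cat" where
  "CrsGrp sets A =
     (let Ob = {G. crossed_group A G \<and> (\<forall>a\<in>Obj A. sets (carrier (grp G a)))} in
      \<lparr>Obj = Ob,
       Arr = {(G, \<alpha>, H). G \<in> Ob \<and> H \<in> Ob \<and> \<alpha> \<in> crossed_maps A G H},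
       Dom = (\<lambda>(G, \<alpha>, H). G),
       Cod = (\<lambda>(G, \<alpha>, H). H),
       Idn = (\<lambda>G. (G, \<lambda>a\<in>Obj A. \<lambda>x\<in>carrier (grp G a). x, G)),
       Cmp = (\<lambda>(H, \<beta>, K) (G, \<alpha>, H'). (G, \<lambda>a\<in>Obj A. compose (carrier (grp G a)) (\<beta> a) (\<alpha> a), K))\<rparr>)"

section \<open>Well-definedness and satisfiability\<close>

lemma crossed_maps_Idn:
  assumes "crossed_group A G"
  shows "(\<lambda>a\<in>Obj A. \<lambda>x\<in>carrier (grp G a). x) \<in> crossed_maps A G G"
proof -
  interpret crossed_group A G by fact
  have "a \<in> Obj A" "b \<in> Obj A" if "\<phi> \<in> arrows A a b" for a b \<phi>
    using that Dom_in Cod_in by (auto simp: arrows_def)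
  then show ?thesis
    by (auto simp: crossed_maps_def hom_def res_in group.is_monoid[OF group_grp] monoid.m_closed)
qed

lemma crossed_maps_Cmp:
  assumes "crossed_group A G" "crossed_group A H"
    and \<alpha>: "\<alpha> \<in> crossed_maps A G H" and \<beta>: "\<beta> \<in> crossed_maps A H K"
  shows "(\<lambda>a\<in>Obj A. compose (carrier (grp G a)) (\<beta> a) (\<alpha> a)) \<in> crossed_maps A G K"
proof -
  interpret G: crossed_group A G by fact
  interpret H: crossed_group A H by fact
  have ob: "a \<in> Obj A" "b \<in> Obj A" if "\<phi> \<in> arrows A a b" for a b \<phi>
    using that G.Dom_in G.Cod_in by (auto simp: arrows_def)
  have 1: "\<alpha> a x \<in> carrier (grp H a)" if "a \<in> Obj A" "x \<in> carrier (grp G a)" for a x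
    using \<alpha> that by (auto simp: crossed_maps_def PiE_iff)
  have 2: "\<beta> a x \<in> carrier (grp K a)" if "a \<in> Obj A" "x \<in> carrier (grp H a)" for a x
    using \<beta> that by (auto simp: crossed_maps_def PiE_iff)
  have h: "compose (carrier (grp G a)) (\<beta> a) (\<alpha> a) \<in> hom (grp G a) (grp K a)" if "a \<in> Obj A" for a
    using \<alpha> \<beta> that G.group_grp[OF that] group.hom_compose[of "grp G a" "\<alpha> a" "grp H a" "\<beta> a" "grp K a"]
    by (auto simp: crossed_maps_def hom_def Pi_iff compose_def group.is_monoid monoid.m_closed)
  show ?thesis
    unfolding crossed_maps_def
  proof (intro CollectI conjI ballI allI)
    show "(\<lambda>a\<in>Obj A. compose (carrier (grp G a)) (\<beta> a) (\<alpha> a))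
        \<in> (\<Pi>\<^sub>E a\<in>Obj A. carrier (grp G a) \<rightarrow>\<^sub>E carrier (grp K a))"
      using 1 2 by (auto simp: compose_def)
  next
    fix a assume "a \<in> Obj A"
    then show "(\<lambda>a\<in>Obj A. compose (carrier (grp G a)) (\<beta> a) (\<alpha> a)) a \<in> hom (grp G a) (grp K a)"
      using h by simp
  next
    fix a b \<phi> x assume A: "\<phi> \<in> arrows A a b" "x \<in> carrier (grp G b)"
    note o = ob[OF A(1)]
    have "\<alpha> a (res G \<phi> x) = res H \<phi> (\<alpha> b x)" "act G a b x \<phi> = act H a b (\<alpha> b x) \<phi>"
      using \<alpha> A by (auto simp: crossed_maps_def)
    moreover have "\<beta> a (res H \<phi> (\<alpha> b x)) = res K \<phi> (\<beta> b (\<alpha> b x))"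
      "act H a b (\<alpha> b x) \<phi> = act K a b (\<beta> b (\<alpha> b x)) \<phi>"
      using \<beta> A 1[OF o(2) A(2)] by (auto simp: crossed_maps_def)
    moreover have "res G \<phi> x \<in> carrier (grp G a)" using G.res_in A by blast
    ultimately show
      "(\<lambda>a\<in>Obj A. compose (carrier (grp G a)) (\<beta> a) (\<alpha> a)) a (res G \<phi> x) =
       res K \<phi> ((\<lambda>a\<in>Obj A. compose (carrier (grp G a)) (\<beta> a) (\<alpha> a)) b x)"
      "act G a b x \<phi> = act K a b ((\<lambda>a\<in>Obj A. compose (carrier (grp G a)) (\<beta> a) (\<alpha> a)) b x) \<phi>"
      using o A by (simp_all add: compose_eq)
  qed
qed

lemma arrows_CrsGrp:
  "f \<in> arrows (CrsGrp sets A) G H \<longleftrightarrow> G \<in> Obj (CrsGrp sets A) \<and> H \<in> Obj (CrsGrp sets A) \<and>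
     (\<exists>\<alpha>\<in>crossed_maps A G H. f = (G, \<alpha>, H))"
  by (auto simp: arrows_def CrsGrp_def Let_def)

lemma category_CrsGrp:
  fixes A :: "('o, 'm) cat" and sets :: "'x set \<Rightarrow> bool"
  shows "category (CrsGrp sets A)"
proof
  fix f :: "('o, 'm, 'x) crossed \<times> ('o \<Rightarrow> 'x \<Rightarrow> 'x) \<times> ('o, 'm, 'x) crossed"
  assume "f \<in> Arr (CrsGrp sets A)"
  then show "Dom (CrsGrp sets A) f \<in> Obj (CrsGrp sets A)"
    "Cod (CrsGrp sets A) f \<in> Obj (CrsGrp sets A)"
    by (auto simp: CrsGrp_def Let_def)
next
  fix G :: "('o, 'm, 'x) crossed"
  assume "G \<in> Obj (CrsGrp sets A)"
  then show "Idn (CrsGrp sets A) G \<in> arrows (CrsGrp sets A) G G"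
    unfolding arrows_CrsGrp by (auto simp: CrsGrp_def Let_def crossed_maps_Idn)
next
  fix f g :: "('o, 'm, 'x) crossed \<times> ('o \<Rightarrow> 'x \<Rightarrow> 'x) \<times> ('o, 'm, 'x) crossed" and G H K
  assume "f \<in> arrows (CrsGrp sets A) G H" "g \<in> arrows (CrsGrp sets A) H K"
  then show "Cmp (CrsGrp sets A) g f \<in> arrows (CrsGrp sets A) G K"
    unfolding arrows_CrsGrp by (auto simp: CrsGrp_def Let_def intro: crossed_maps_Cmp)
next
  fix f :: "('o, 'm, 'x) crossed \<times> ('o \<Rightarrow> 'x \<Rightarrow> 'x) \<times> ('o, 'm, 'x) crossed" and G H
  assume "f \<in> arrows (CrsGrp sets A) G H"
  then obtain \<alpha> where f: "f = (G, \<alpha>, H)" "\<alpha> \<in> crossed_maps A G H"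
    unfolding arrows_CrsGrp by auto
  then have *: "\<alpha> \<in> (\<Pi>\<^sub>E a\<in>Obj A. carrier (grp G a) \<rightarrow>\<^sub>E carrier (grp H a))"
    by (simp add: crossed_maps_def)
  then have "(\<lambda>a\<in>Obj A. compose (carrier (grp G a)) (\<alpha> a)
      ((\<lambda>a\<in>Obj A. \<lambda>x\<in>carrier (grp G a). x) a)) = \<alpha>"
    "(\<lambda>a\<in>Obj A. compose (carrier (grp G a))
      ((\<lambda>a\<in>Obj A. \<lambda>x\<in>carrier (grp H a). x) a) (\<alpha> a)) = \<alpha>"
    by ((intro ext; auto simp: restrict_def compose_def PiE_iff extensional_def)+)
  then show "Cmp (CrsGrp sets A) f (Idn (CrsGrp sets A) G) = f"
    "Cmp (CrsGrp sets A) (Idn (CrsGrp sets A) H) f = f"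
    by (simp_all add: f(1) CrsGrp_def Let_def)
next
  fix f g h :: "('o, 'm, 'x) crossed \<times> ('o \<Rightarrow> 'x \<Rightarrow> 'x) \<times> ('o, 'm, 'x) crossed" and G H K L
  assume "f \<in> arrows (CrsGrp sets A) G H" "g \<in> arrows (CrsGrp sets A) H K"
    "h \<in> arrows (CrsGrp sets A) K L"
  then obtain \<alpha> \<beta> \<gamma> where f: "f = (G, \<alpha>, H)" "g = (H, \<beta>, K)" "h = (K, \<gamma>, L)"
    "\<alpha> \<in> crossed_maps A G H"
    unfolding arrows_CrsGrp by auto
  then have *: "\<alpha> \<in> (\<Pi>\<^sub>E a\<in>Obj A. carrier (grp G a) \<rightarrow>\<^sub>E carrier (grp H a))"
    by (simp add: crossed_maps_def)
  then show "Cmp (CrsGrp sets A) h (Cmp (CrsGrp sets A) g f) =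
      Cmp (CrsGrp sets A) (Cmp (CrsGrp sets A) h g) f"
    by (auto simp: f(1-3) CrsGrp_def Let_def fun_eq_iff restrict_def compose_def PiE_iff)
qed

lemma lepoll_UNIV_imp_eqpoll_set:
  assumes "Z \<lesssim> (UNIV :: 'y set)"
  shows "\<exists>Y :: 'y set. Y \<approx> Z"
  using assms by (metis eqpoll_sym inj_on_image_eqpoll_self lepoll_def)

lemma size_universe_fun:
  assumes "infinite (UNIV :: 'i set)"
  shows "size_universe (\<lambda>X :: ('i \<Rightarrow> bool) set. X \<lesssim> (UNIV :: 'i set)) (\<lambda>_. True)"
proof -
  have pair: "\<exists>k :: 'i \<times> 'i \<Rightarrow> 'i. inj k"
    using card_of_Times_same_infinite[OF assms]
    by (metis UNIV_Times_UNIV bij_betw_imp_inj_on card_of_ordIso)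
  then obtain k :: "'i \<times> 'i \<Rightarrow> 'i" where k: "inj k" by blast
  have Pi: "Pi\<^sub>E I X \<lesssim> (UNIV :: ('i \<Rightarrow> bool) set)" if I: "I \<lesssim> (UNIV :: 'i set)"
    for I :: "('i \<Rightarrow> bool) set" and X :: "('i \<Rightarrow> bool) \<Rightarrow> ('i \<Rightarrow> bool) set"
  proof -
    obtain e :: "('i \<Rightarrow> bool) \<Rightarrow> 'i" where e: "inj_on e I" using I by (auto simp: lepoll_def)
    define F where "F f = (\<lambda>n. \<exists>i\<in>I. \<exists>j. n = k (e i, j) \<and> f i j)" for f :: "('i \<Rightarrow> bool) \<Rightarrow> 'i \<Rightarrow> bool"
    have F: "F f (k (e i, j)) \<longleftrightarrow> f i j" if "i \<in> I" for f i j
      using that e k by (auto simp: F_def inj_eq inj_on_eq_iff)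
    have "inj_on F (Pi\<^sub>E I X)"
    proof (rule inj_onI)
      fix f g assume "f \<in> Pi\<^sub>E I X" "g \<in> Pi\<^sub>E I X" "F f = F g"
      then show "f = g" by (intro PiE_ext[of f I X g]) (auto simp: fun_eq_iff F[symmetric])
    qed
    then show ?thesis by (auto simp: lepoll_def)
  qed
  have Si: "Sigma I X \<lesssim> (UNIV :: ('i \<Rightarrow> bool) set)"
    for I :: "('i \<Rightarrow> bool) set" and X :: "('i \<Rightarrow> bool) \<Rightarrow> ('i \<Rightarrow> bool) set"
  proof -
    obtain p q :: 'i where "p \<noteq> q" using infinite_arbitrarily_large[OF assms, of 2] by (auto simp: card_2_iff)
    define F where "F = (\<lambda>(f, g). \<lambda>n. (\<exists>j. n = k (p, j) \<and> f j) \<or> (\<exists>j. n = k (q, j) \<and> (g j :: bool)))"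
    have F: "F (f, g) (k (p, j)) \<longleftrightarrow> f j" "F (f, g) (k (q, j)) \<longleftrightarrow> g j" for f g j
      using k \<open>p \<noteq> q\<close> by (auto simp: F_def inj_eq)
    have "inj F"
    proof (rule injI)
      fix x y assume "F x = F y"
      then have "fst x j = fst y j" "snd x j = snd y j" for j
        using F[of "fst x" "snd x" j] F[of "fst y" "snd y" j] by auto
      then show "x = y" by (simp add: prod_eq_iff fun_eq_iff)
    qed
    then have "inj_on F (Sigma I X)" by (rule inj_on_subset) simp
    then show ?thesis unfolding lepoll_def by blast
  qed
  have inf: "\<exists>X :: ('i \<Rightarrow> bool) set. X \<lesssim> (UNIV :: 'i set) \<and> infinite X"
  proof (intro exI conjI)
    show "range (\<lambda>i j :: 'i. i = j) \<lesssim> (UNIV :: 'i set)" by (rule image_lepoll)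
    have "inj (\<lambda>i j :: 'i. i = j)" by (auto simp: inj_def fun_eq_iff)
    then show "infinite (range (\<lambda>i j :: 'i. i = j))" using assms by (simp add: finite_image_iff)
  qed
  show ?thesis
    by unfold_locales
      (use inf in \<open>auto intro: lepoll_trans lepoll_UNIV_imp_eqpoll_set Pi Si\<close>)
qed

end

theory Submission
  imports Defs
begin

text \<open>
  An element \<open>x \<in> G(a)\<close> determines, for each arrow \<open>\<phi>\<close> into \<open>a\<close>, the permutation by which
  \<open>\<phi>\<^sup>*x\<close> acts on the arrows into the domain of \<open>\<phi>\<close>. All families of permutations that are
  compatible with composition form a crossed group, which is terminal. Limits are computed as
  limits of sets over the terminal crossed group. For colimits, words in the elements of the diagram carry an action and restrictions forced by the
  axioms; identifying words that have the same value in every cocone gives the colimit, the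
  cocone into the terminal crossed group ensuring that the action descends.
\<close>

section \<open>Crossed groups by elements\<close>

text \<open>A map must preserve the action on the fixed sets of arrows, so a plain product of
  crossed groups has in general no action compatible with its projections: a tuple can act only if
  all its entries act alike. Axiom (ii) adds a second obstacle. It twists restriction, which
  therefore is not a homomorphism, and quotients cannot be formed one group at a time. One device
  meets both: a structure with unit, multiplication, restriction and action inherits the axioms of
  crossed groups from a jointly injective family of structure-preserving maps into crossed groups,
  once inverses are supplied (\<open>crossed_group_jointly_embedded\<close>). Limits embed by their
  projections, colimits by evaluation in the cocones, so no congruence on words has to be generated.
  The elements so constructed are functions, tuples and lists, while objects of
  \<open>CrsGrp\<close> have elements in the universe type. Each construction is therefore made in
  its own type and then moved along bijections, which is what the cardinality bounds are
  for.\<close>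

lemma (in category) arrows_Obj:
  assumes "\<phi> \<in> arrows C a b"
  shows "a \<in> Obj C" "b \<in> Obj C"
  using assms Dom_in Cod_in by (auto simp: arrows_def)

text \<open>A \<open>group_action\<close> is a homomorphism into \<open>BijGroup E\<close>, whose
  elements are extensional bijections; hence the extensionality hypothesis. Bijectivity comes from
  the action laws, since the inverse of x undoes x.\<close>

lemma group_actionI:
  assumes "group G"
    and closed: "\<And>x e. \<lbrakk>x \<in> carrier G; e \<in> E\<rbrakk> \<Longrightarrow> f x e \<in> E"
    and ext: "\<And>x. x \<in> carrier G \<Longrightarrow> f x \<in> extensional E"
    and one: "\<And>e. e \<in> E \<Longrightarrow> f \<one>\<^bsub>G\<^esub> e = e"
    and mult: "\<And>x y e. \<lbrakk>x \<in> carrier G; y \<in> carrier G; e \<in> E\<rbrakk> \<Longrightarrow> f (x \<otimes>\<^bsub>G\<^esub> y) e = f x (f y e)"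
  shows "group_action G E f"
proof -
  interpret group G by fact
  have Bij: "f x \<in> Bij E" if x: "x \<in> carrier G" for x
  proof -
    have "f x (f (inv\<^bsub>G\<^esub> x) e) = e" "f (inv\<^bsub>G\<^esub> x) (f x e) = e" if "e \<in> E" for e
      using that x mult[of x "inv\<^bsub>G\<^esub> x" e] mult[of "inv\<^bsub>G\<^esub> x" x e] one by simp_all
    then have "bij_betw (f x) E E"
      by (intro bij_betw_byWitness[where f' = "f (inv\<^bsub>G\<^esub> x)"]) (use x closed in auto)
    then show ?thesis using ext[OF x] by (simp add: Bij_def)
  qed
  have "f \<in> hom G (BijGroup E)"
  proof (rule homI)
    show "f x \<in> carrier (BijGroup E)" if "x \<in> carrier G" for x
      using Bij[OF that] by (simp add: BijGroup_def)
    show "f (x \<otimes>\<^bsub>G\<^esub> y) = f x \<otimes>\<^bsub>BijGroup E\<^esub> f y" if "x \<in> carrier G" "y \<in> carrier G" for x y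
      by (rule extensionalityI[of _ E]) (use that Bij ext mult in \<open>simp_all add: BijGroup_def compose_def\<close>)
  qed
  then have "group_hom G (BijGroup E) f"
    by unfold_locales (use group_BijGroup[of E] in \<open>auto simp: group_hom_axioms_def group_def group_axioms_def
      monoid.one_closed monoid.m_closed monoid.m_assoc monoid.l_one monoid.r_one\<close>)
  then show ?thesis by (rule group_action.intro)
qed

text \<open>One-sided units and inverses suffice for a group, and the action laws make the action
  bijective, so the axioms reduce to closure, extensionality, existence of left inverses and
  equations.\<close>

lemma crossed_groupI:
  fixes G :: "('o, 'm, 'x) crossed"
  assumes "category A"
    and res_in: "\<And>a b \<phi> x. \<lbrakk>\<phi> \<in> arrows A a b; x \<in> carrier (grp G b)\<rbrakk> \<Longrightarrow> res G \<phi> x \<in> carrier (grp G a)"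
    and res_Idn: "\<And>a x. \<lbrakk>a \<in> Obj A; x \<in> carrier (grp G a)\<rbrakk> \<Longrightarrow> res G (Idn A a) x = x"
    and res_Cmp: "\<And>a b c \<phi> \<psi> x. \<lbrakk>\<phi> \<in> arrows A a b; \<psi> \<in> arrows A b c; x \<in> carrier (grp G c)\<rbrakk>
      \<Longrightarrow> res G (Cmp A \<psi> \<phi>) x = res G \<phi> (res G \<psi> x)"
    and one: "\<And>a. a \<in> Obj A \<Longrightarrow> \<one>\<^bsub>grp G a\<^esub> \<in> carrier (grp G a)"
    and mult: "\<And>a x y. \<lbrakk>a \<in> Obj A; x \<in> carrier (grp G a); y \<in> carrier (grp G a)\<rbrakk>
      \<Longrightarrow> x \<otimes>\<^bsub>grp G a\<^esub> y \<in> carrier (grp G a)"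
    and assoc: "\<And>a x y z. \<lbrakk>a \<in> Obj A; x \<in> carrier (grp G a); y \<in> carrier (grp G a); z \<in> carrier (grp G a)\<rbrakk>
      \<Longrightarrow> (x \<otimes>\<^bsub>grp G a\<^esub> y) \<otimes>\<^bsub>grp G a\<^esub> z = x \<otimes>\<^bsub>grp G a\<^esub> (y \<otimes>\<^bsub>grp G a\<^esub> z)"
    and l_one: "\<And>a x. \<lbrakk>a \<in> Obj A; x \<in> carrier (grp G a)\<rbrakk> \<Longrightarrow> \<one>\<^bsub>grp G a\<^esub> \<otimes>\<^bsub>grp G a\<^esub> x = x"
    and l_inv: "\<And>a x. \<lbrakk>a \<in> Obj A; x \<in> carrier (grp G a)\<rbrakk>
      \<Longrightarrow> \<exists>y\<in>carrier (grp G a). y \<otimes>\<^bsub>grp G a\<^esub> x = \<one>\<^bsub>grp G a\<^esub>"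
    and act_in: "\<And>a b \<phi> x. \<lbrakk>\<phi> \<in> arrows A a b; x \<in> carrier (grp G b)\<rbrakk> \<Longrightarrow> act G a b x \<phi> \<in> arrows A a b"
    and act_ext: "\<And>a b x. \<lbrakk>a \<in> Obj A; b \<in> Obj A; x \<in> carrier (grp G b)\<rbrakk>
      \<Longrightarrow> act G a b x \<in> extensional (arrows A a b)"
    and act_one: "\<And>a b \<phi>. \<phi> \<in> arrows A a b \<Longrightarrow> act G a b \<one>\<^bsub>grp G b\<^esub> \<phi> = \<phi>"
    and act_mult: "\<And>a b \<phi> x y. \<lbrakk>\<phi> \<in> arrows A a b; x \<in> carrier (grp G b); y \<in> carrier (grp G b)\<rbrakk>
      \<Longrightarrow> act G a b (x \<otimes>\<^bsub>grp G b\<^esub> y) \<phi> = act G a b x (act G a b y \<phi>)"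
    and act_Cmp: "\<And>a b c \<phi> \<psi> x. \<lbrakk>\<phi> \<in> arrows A a b; \<psi> \<in> arrows A b c; x \<in> carrier (grp G c)\<rbrakk>
      \<Longrightarrow> act G a c x (Cmp A \<psi> \<phi>) = Cmp A (act G b c x \<psi>) (act G a b (res G \<psi> x) \<phi>)"
    and res_mult: "\<And>a b \<phi> x y. \<lbrakk>\<phi> \<in> arrows A a b; x \<in> carrier (grp G b); y \<in> carrier (grp G b)\<rbrakk>
      \<Longrightarrow> res G \<phi> (x \<otimes>\<^bsub>grp G b\<^esub> y) = res G (act G a b y \<phi>) x \<otimes>\<^bsub>grp G a\<^esub> res G \<phi> y"
  shows "crossed_group A G"
proof -
  interpret category A by fact
  have group: "group (grp G a)" if "a \<in> Obj A" for a
    by (rule groupI) (use that one mult assoc l_one l_inv in auto)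
  have act: "group_action (grp G b) (arrows A a b) (act G a b)" if "a \<in> Obj A" "b \<in> Obj A" for a b
    by (rule group_actionI) (use that group act_in act_ext act_one act_mult in auto)
  show ?thesis
    by (intro crossed_group.intro presheaf.intro presheaf_axioms.intro crossed_group_axioms.intro)
      (fact | rule assms group act; assumption)+
qed

section \<open>Elementwise laws of a crossed group\<close>

context crossed_group
begin

lemmas res_closed = res_in and res_identity = res_Idn and res_comp = res_Cmp

lemma one_in: "a \<in> Obj A \<Longrightarrow> \<one>\<^bsub>grp G a\<^esub> \<in> carrier (grp G a)"
  by (simp add: group.is_monoid group_grp)

lemma mult_in:
  "\<lbrakk>a \<in> Obj A; x \<in> carrier (grp G a); y \<in> carrier (grp G a)\<rbrakk> \<Longrightarrow> x \<otimes>\<^bsub>grp G a\<^esub> y \<in> carrier (grp G a)"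
  by (simp add: group.is_monoid group_grp monoid.m_closed)

lemma inv_in: "\<lbrakk>a \<in> Obj A; x \<in> carrier (grp G a)\<rbrakk> \<Longrightarrow> inv\<^bsub>grp G a\<^esub> x \<in> carrier (grp G a)"
  by (simp add: group_grp)

lemma act_group_action:
  "\<phi> \<in> arrows A a b \<Longrightarrow> group_action (grp G b) (arrows A a b) (act G a b)"
  using action arrows_Obj by blast

lemma act_ext:
  assumes "a \<in> Obj A" "b \<in> Obj A" "x \<in> carrier (grp G b)"
  shows "act G a b x \<in> extensional (arrows A a b)"
proof -
  interpret group_action "grp G b" "arrows A a b" "act G a b" using action assms by blast
  have "act G a b x \<in> carrier (BijGroup (arrows A a b))"
    using group_hom assms(3) by (simp add: group_hom.hom_closed)
  then show ?thesis by (simp add: BijGroup_def Bij_def)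
qed

lemma act_in: "\<lbrakk>\<phi> \<in> arrows A a b; x \<in> carrier (grp G b)\<rbrakk> \<Longrightarrow> act G a b x \<phi> \<in> arrows A a b"
  using group_action.element_image[OF act_group_action] by blast

lemma act_one: "\<phi> \<in> arrows A a b \<Longrightarrow> act G a b \<one>\<^bsub>grp G b\<^esub> \<phi> = \<phi>"
  using group_action.id_eq_one[OF act_group_action] by (metis restrict_apply')

lemma act_mult:
  "\<lbrakk>\<phi> \<in> arrows A a b; x \<in> carrier (grp G b); y \<in> carrier (grp G b)\<rbrakk>
    \<Longrightarrow> act G a b (x \<otimes>\<^bsub>grp G b\<^esub> y) \<phi> = act G a b x (act G a b y \<phi>)"
  using group_action.composition_rule[OF act_group_action] by blast

lemma act_bij:
  assumes "a \<in> Obj A" "b \<in> Obj A" "x \<in> carrier (grp G b)"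
  shows "bij_betw (act G a b x) (arrows A a b) (arrows A a b)"
  using group_action.bij_prop0[OF action[OF assms(1,2)] assms(3)] by (simp add: Bij_def)

text \<open>Restriction is no homomorphism, but the unit acts trivially, so axiom (ii) at x = y = 1
  makes the restricted unit an idempotent of a group.\<close>

lemma res_one:
  assumes "\<phi> \<in> arrows A a b"
  shows "res G \<phi> \<one>\<^bsub>grp G b\<^esub> = \<one>\<^bsub>grp G a\<^esub>"
proof -
  have ab: "a \<in> Obj A" "b \<in> Obj A" using assms arrows_Obj by blast+
  interpret a: group "grp G a" using ab group_grp by blast
  interpret b: group "grp G b" using ab group_grp by blast
  have "res G \<phi> \<one>\<^bsub>grp G b\<^esub> \<otimes>\<^bsub>grp G a\<^esub> res G \<phi> \<one>\<^bsub>grp G b\<^esub> = res G \<phi> \<one>\<^bsub>grp G b\<^esub>"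
    using res_mult[OF assms b.one_closed b.one_closed] assms by (simp add: act_one)
  then show ?thesis using res_in[OF assms b.one_closed] by (metis a.l_cancel_one')
qed

end

section \<open>Homomorphisms\<close>

text \<open>Unlike in \<open>crossed_maps\<close>, the two element types may differ and values off
  the carriers are unconstrained, so that permutation families, tuples and words can be compared
  with objects of \<open>CrsGrp\<close>.\<close>

definition crossed_hom ::
  "('o, 'm) cat \<Rightarrow> ('o, 'm, 'x) crossed \<Rightarrow> ('o, 'm, 'y) crossed \<Rightarrow> ('o \<Rightarrow> 'x \<Rightarrow> 'y) \<Rightarrow> bool" where
  "crossed_hom A G H f \<longleftrightarrow> (\<forall>a\<in>Obj A. f a \<in> hom (grp G a) (grp H a)) \<and>
     (\<forall>a b. \<forall>\<phi>\<in>arrows A a b. \<forall>x\<in>carrier (grp G b). f a (res G \<phi> x) = res H \<phi> (f b x)) \<and>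
     (\<forall>a b. \<forall>\<phi>\<in>arrows A a b. \<forall>x\<in>carrier (grp G b). act G a b x \<phi> = act H a b (f b x) \<phi>)"

lemma crossed_homI:
  assumes "\<And>a x. \<lbrakk>a \<in> Obj A; x \<in> carrier (grp G a)\<rbrakk> \<Longrightarrow> f a x \<in> carrier (grp H a)"
    and "\<And>a x y. \<lbrakk>a \<in> Obj A; x \<in> carrier (grp G a); y \<in> carrier (grp G a)\<rbrakk>
      \<Longrightarrow> f a (x \<otimes>\<^bsub>grp G a\<^esub> y) = f a x \<otimes>\<^bsub>grp H a\<^esub> f a y"
    and "\<And>a b \<phi> x. \<lbrakk>\<phi> \<in> arrows A a b; x \<in> carrier (grp G b)\<rbrakk> \<Longrightarrow> f a (res G \<phi> x) = res H \<phi> (f b x)"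
    and "\<And>a b \<phi> x. \<lbrakk>\<phi> \<in> arrows A a b; x \<in> carrier (grp G b)\<rbrakk> \<Longrightarrow> act G a b x \<phi> = act H a b (f b x) \<phi>"
  shows "crossed_hom A G H f"
  using assms by (auto simp: crossed_hom_def hom_def)

lemma crossed_homD:
  assumes "crossed_hom A G H f"
  shows "\<lbrakk>a \<in> Obj A; x \<in> carrier (grp G a)\<rbrakk> \<Longrightarrow> f a x \<in> carrier (grp H a)"
    and "\<lbrakk>a \<in> Obj A; x \<in> carrier (grp G a); y \<in> carrier (grp G a)\<rbrakk>
      \<Longrightarrow> f a (x \<otimes>\<^bsub>grp G a\<^esub> y) = f a x \<otimes>\<^bsub>grp H a\<^esub> f a y"
    and "\<lbrakk>\<phi> \<in> arrows A a b; x \<in> carrier (grp G b)\<rbrakk> \<Longrightarrow> f a (res G \<phi> x) = res H \<phi> (f b x)"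
    and "\<lbrakk>\<phi> \<in> arrows A a b; x \<in> carrier (grp G b)\<rbrakk> \<Longrightarrow> act G a b x \<phi> = act H a b (f b x) \<phi>"
  using assms by (auto simp: crossed_hom_def hom_def)

lemma crossed_hom_one:
  assumes "crossed_group A G" "crossed_group A H" "crossed_hom A G H f" "a \<in> Obj A"
  shows "f a \<one>\<^bsub>grp G a\<^esub> = \<one>\<^bsub>grp H a\<^esub>"
  using assms crossed_group.group_grp by (metis crossed_hom_def hom_one)

lemma crossed_hom_inv:
  assumes "crossed_group A G" "crossed_group A H" "crossed_hom A G H f" "a \<in> Obj A"
    "x \<in> carrier (grp G a)"
  shows "f a (inv\<^bsub>grp G a\<^esub> x) = inv\<^bsub>grp H a\<^esub> f a x"
proof -
  have "group_hom (grp G a) (grp H a) (f a)"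
    using assms crossed_group.group_grp[OF assms(1)] crossed_group.group_grp[OF assms(2)]
    by (simp add: crossed_hom_def group_hom_def group_hom_axioms_def)
  then show ?thesis using assms(5) by (rule group_hom.hom_inv)
qed

lemma crossed_hom_comp:
  assumes "category A" and f: "crossed_hom A G H f" and g: "crossed_hom A H K g"
  shows "crossed_hom A G K (\<lambda>a x. g a (f a x))"
proof -
  interpret category A by fact
  show ?thesis
    by (rule crossed_homI) (simp_all add: crossed_homD[OF f] crossed_homD[OF g] arrows_Obj)
qed

lemma crossed_maps_iff:
  "f \<in> crossed_maps A G H \<longleftrightarrow>
    f \<in> (\<Pi>\<^sub>E a\<in>Obj A. carrier (grp G a) \<rightarrow>\<^sub>E carrier (grp H a)) \<and> crossed_hom A G H f"
  by (auto simp: crossed_maps_def crossed_hom_def)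

lemma crossed_maps_restrict:
  assumes "crossed_group A G" "crossed_hom A G H f"
  shows "(\<lambda>a\<in>Obj A. \<lambda>x\<in>carrier (grp G a). f a x) \<in> crossed_maps A G H"
proof -
  interpret crossed_group A G by fact
  note f = crossed_homD[OF assms(2)]
  have "crossed_hom A G H (\<lambda>a\<in>Obj A. \<lambda>x\<in>carrier (grp G a). f a x)"
    by (rule crossed_homI) (simp_all add: f arrows_Obj mult_in res_in)
  then show ?thesis unfolding crossed_maps_iff using f by auto
qed

text \<open>Equations between elements of \<open>G\<close> are tested after the jointly injective
  maps, where they become axioms of the targets. Equations between arrows need only one target,
  because a homomorphism leaves the action unchanged; hence \<open>Q\<close> is nonempty. Inverses
  in the targets need not come from \<open>G\<close>, so one common preimage of them is a
  hypothesis.\<close>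

lemma crossed_group_jointly_embedded:
  fixes G :: "('o, 'm, 'x) crossed" and Q :: "(('o, 'm, 'y) crossed \<times> ('o \<Rightarrow> 'x \<Rightarrow> 'y)) set"
  assumes "category A" and "Q \<noteq> {}"
    and M: "\<And>M f. (M, f) \<in> Q \<Longrightarrow> crossed_group A M"
    and hom: "\<And>M f. (M, f) \<in> Q \<Longrightarrow> crossed_hom A G M f"
    and one: "\<And>M f a. \<lbrakk>(M, f) \<in> Q; a \<in> Obj A\<rbrakk> \<Longrightarrow> f a \<one>\<^bsub>grp G a\<^esub> = \<one>\<^bsub>grp M a\<^esub>"
    and inj: "\<And>a x y. \<lbrakk>a \<in> Obj A; x \<in> carrier (grp G a); y \<in> carrier (grp G a);
      \<And>M f. (M, f) \<in> Q \<Longrightarrow> f a x = f a y\<rbrakk> \<Longrightarrow> x = y"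
    and one_in: "\<And>a. a \<in> Obj A \<Longrightarrow> \<one>\<^bsub>grp G a\<^esub> \<in> carrier (grp G a)"
    and mult_in: "\<And>a x y. \<lbrakk>a \<in> Obj A; x \<in> carrier (grp G a); y \<in> carrier (grp G a)\<rbrakk>
      \<Longrightarrow> x \<otimes>\<^bsub>grp G a\<^esub> y \<in> carrier (grp G a)"
    and inv: "\<And>a x. \<lbrakk>a \<in> Obj A; x \<in> carrier (grp G a)\<rbrakk>
      \<Longrightarrow> \<exists>y\<in>carrier (grp G a). \<forall>(M, f)\<in>Q. f a y = inv\<^bsub>grp M a\<^esub> f a x"
    and res_in: "\<And>a b \<phi> x. \<lbrakk>\<phi> \<in> arrows A a b; x \<in> carrier (grp G b)\<rbrakk> \<Longrightarrow> res G \<phi> x \<in> carrier (grp G a)"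
    and act_ext: "\<And>a b x. \<lbrakk>a \<in> Obj A; b \<in> Obj A; x \<in> carrier (grp G b)\<rbrakk>
      \<Longrightarrow> act G a b x \<in> extensional (arrows A a b)"
  shows "crossed_group A G"
proof -
  interpret category A by fact
  note Q_simps = crossed_homD[OF hom] arrows_Obj Cmp_in mult_in res_in one one_in Idn_in
    crossed_group.mult_in[OF M] crossed_group.res_closed[OF M] crossed_group.one_in[OF M]
  have grp: "group (grp M a)" if "(M, f) \<in> Q" "a \<in> Obj A" for M f a
    using M[OF that(1)] that(2) by (rule crossed_group.group_grp)
  obtain M\<^sub>0 f\<^sub>0 where Q0: "(M\<^sub>0, f\<^sub>0) \<in> Q" using \<open>Q \<noteq> {}\<close> by auto
  interpret M0: crossed_group A M\<^sub>0 using M Q0 .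
  note f0 = crossed_homD[OF hom[OF Q0]]
  have act0: "act G a b x \<phi> \<in> arrows A a b" if "\<phi> \<in> arrows A a b" "x \<in> carrier (grp G b)" for a b x \<phi>
    using that M0.act_in f0 arrows_Obj by metis
  show ?thesis
  proof (rule crossed_groupI)
    fix a b \<phi> x assume \<phi>: "\<phi> \<in> arrows A a b" and x: "x \<in> carrier (grp G b)"
    show "act G a b x \<phi> \<in> arrows A a b" by (rule act0) fact+
    fix y assume y: "y \<in> carrier (grp G b)"
    note [simp] = arrows_Obj[OF \<phi>]
    show "act G a b (x \<otimes>\<^bsub>grp G b\<^esub> y) \<phi> = act G a b x (act G a b y \<phi>)"
    proof -
      have "act G a b (x \<otimes>\<^bsub>grp G b\<^esub> y) \<phi> = act M\<^sub>0 a b (f\<^sub>0 b x) (act M\<^sub>0 a b (f\<^sub>0 b y) \<phi>)"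
        using \<phi> x y by (simp add: mult_in f0 M0.act_mult)
      also have "\<dots> = act G a b x (act G a b y \<phi>)"
        using \<phi> x y act0[OF \<phi> y] by (simp add: f0)
      finally show ?thesis .
    qed
    show "res G \<phi> (x \<otimes>\<^bsub>grp G b\<^esub> y) = res G (act G a b y \<phi>) x \<otimes>\<^bsub>grp G a\<^esub> res G \<phi> y"
    proof (rule inj)
      fix M f assume Q: "(M, f) \<in> Q"
      have "f a (res G \<phi> (x \<otimes>\<^bsub>grp G b\<^esub> y)) = res M \<phi> (f b x \<otimes>\<^bsub>grp M b\<^esub> f b y)"
        using Q \<phi> x y by (simp add: Q_simps)
      also have "\<dots> = res M (act M a b (f b y) \<phi>) (f b x) \<otimes>\<^bsub>grp M a\<^esub> res M \<phi> (f b y)"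
        using Q \<phi> x y by (simp add: Q_simps crossed_group.res_mult[OF M])
      \<comment> \<open>The arrow along which axiom (ii) restricts the left factor is the same in
        \<open>M\<close> as in \<open>G\<close>, which makes the result the image of one expression
        in \<open>G\<close>.\<close>
      also have "act M a b (f b y) \<phi> = act G a b y \<phi>"
        using Q \<phi> y by (simp add: Q_simps)
      also have "res M (act G a b y \<phi>) (f b x) = f a (res G (act G a b y \<phi>) x)"
        using Q \<phi> x y act0[OF \<phi> y] by (simp add: Q_simps)
      finally show "f a (res G \<phi> (x \<otimes>\<^bsub>grp G b\<^esub> y)) = f a (res G (act G a b y \<phi>) x \<otimes>\<^bsub>grp G a\<^esub> res G \<phi> y)"
        using Q \<phi> x y act0[OF \<phi> y] by (simp add: Q_simps)
    qed (use res_in[OF \<phi> mult_in[OF _ x y]] res_in[OF act0[OF \<phi> y] x] res_in[OF \<phi> y] in \<open>auto intro: mult_in\<close>)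
  next
    fix a b c \<phi> \<psi> x
    assume \<phi>: "\<phi> \<in> arrows A a b" and \<psi>: "\<psi> \<in> arrows A b c" and x: "x \<in> carrier (grp G c)"
    note [simp] = arrows_Obj[OF \<phi>] arrows_Obj[OF \<psi>]
    have \<psi>\<phi>: "Cmp A \<psi> \<phi> \<in> arrows A a c" using \<phi> \<psi> by (rule Cmp_in)
    show "res G (Cmp A \<psi> \<phi>) x = res G \<phi> (res G \<psi> x)"
    proof (rule inj)
      fix M f assume Q: "(M, f) \<in> Q"
      show "f a (res G (Cmp A \<psi> \<phi>) x) = f a (res G \<phi> (res G \<psi> x))"
        using \<phi> \<psi> \<psi>\<phi> x crossed_homD[OF hom[OF Q]] res_in[OF \<psi> x] crossed_group.res_comp[OF M[OF Q] \<phi> \<psi>]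
        by simp
    qed (use \<phi> \<psi> \<psi>\<phi> x in \<open>auto intro: res_in\<close>)
    show "act G a c x (Cmp A \<psi> \<phi>) = Cmp A (act G b c x \<psi>) (act G a b (res G \<psi> x) \<phi>)"
      using \<phi> \<psi> \<psi>\<phi> x res_in[OF \<psi> x] f0 M0.act_Cmp[OF \<phi> \<psi>] by simp
  next
    fix a x assume a: "a \<in> Obj A" and x: "x \<in> carrier (grp G a)"
    show "res G (Idn A a) x = x"
    proof (rule inj)
      fix M f assume Q: "(M, f) \<in> Q"
      show "f a (res G (Idn A a) x) = f a x"
        using a x crossed_homD(1)[OF hom[OF Q]] crossed_homD(3)[OF hom[OF Q] Idn_in[OF a] x]
          crossed_group.res_identity[OF M[OF Q]] by simp
    qed (use a x Idn_in in \<open>auto intro: res_in\<close>)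
    show "\<one>\<^bsub>grp G a\<^esub> \<otimes>\<^bsub>grp G a\<^esub> x = x"
    proof (rule inj)
      fix M f assume Q: "(M, f) \<in> Q"
      interpret group "grp M a" using Q a by (rule grp)
      show "f a (\<one>\<^bsub>grp G a\<^esub> \<otimes>\<^bsub>grp G a\<^esub> x) = f a x" using Q a x by (simp add: Q_simps)
    qed (use a x in \<open>auto intro: mult_in one_in\<close>)
    obtain y where y: "y \<in> carrier (grp G a)" "\<forall>(M, f)\<in>Q. f a y = inv\<^bsub>grp M a\<^esub> f a x"
      using inv[OF a x] by blast
    have "y \<otimes>\<^bsub>grp G a\<^esub> x = \<one>\<^bsub>grp G a\<^esub>"
    proof (rule inj)
      fix M f assume Q: "(M, f) \<in> Q"
      then show "f a (y \<otimes>\<^bsub>grp G a\<^esub> x) = f a \<one>\<^bsub>grp G a\<^esub>"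
        using a x y grp[OF Q a] by (auto simp: Q_simps group.l_inv)
    qed (use a x y in \<open>auto intro: mult_in one_in\<close>)
    then show "\<exists>y\<in>carrier (grp G a). y \<otimes>\<^bsub>grp G a\<^esub> x = \<one>\<^bsub>grp G a\<^esub>" using y by blast
    fix y z assume yz: "y \<in> carrier (grp G a)" "z \<in> carrier (grp G a)"
    show "(x \<otimes>\<^bsub>grp G a\<^esub> y) \<otimes>\<^bsub>grp G a\<^esub> z = x \<otimes>\<^bsub>grp G a\<^esub> (y \<otimes>\<^bsub>grp G a\<^esub> z)"
    proof (rule inj)
      fix M f assume Q: "(M, f) \<in> Q"
      interpret group "grp M a" using Q a by (rule grp)
      show "f a ((x \<otimes>\<^bsub>grp G a\<^esub> y) \<otimes>\<^bsub>grp G a\<^esub> z) = f a (x \<otimes>\<^bsub>grp G a\<^esub> (y \<otimes>\<^bsub>grp G a\<^esub> z))"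
        using Q a x yz by (simp add: Q_simps m_assoc)
    qed (use a x yz in \<open>auto intro: mult_in\<close>)
  next
    fix a b \<phi> assume \<phi>: "\<phi> \<in> arrows A a b"
    then show "act G a b \<one>\<^bsub>grp G b\<^esub> \<phi> = \<phi>"
      using f0(4)[OF \<phi>] one[OF Q0] one_in M0.act_one arrows_Obj by metis
  qed (use \<open>category A\<close> one_in mult_in res_in act_ext in auto)
qed


section \<open>The terminal crossed group\<close>

text \<open>This plays the part of \<open>restrict\<close> for two arguments, the domain of the
  second depending on the first: a normalised system is determined by its values on composable
  pairs.\<close>

definition tab :: "('o, 'm) cat \<Rightarrow> 'o \<Rightarrow> ('m \<Rightarrow> 'm \<Rightarrow> 'm) \<Rightarrow> 'm \<Rightarrow> 'm \<Rightarrow> 'm" where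
  "tab A a f = (\<lambda>\<phi> \<psi>. if \<exists>b c. \<phi> \<in> arrows A b a \<and> \<psi> \<in> arrows A c b then f \<phi> \<psi> else undefined)"

text \<open>Think of \<open>t \<phi> \<psi>\<close> as \<psi> acted on by \<phi>^*(x) for an unknown
  x over a. The last clause is then axiom (i) for \<phi>^*(x), whose restriction along \<psi> is
  read off at \<open>Cmp A \<phi> \<psi>\<close>.\<close>

definition perm_systems :: "('o, 'm) cat \<Rightarrow> 'o \<Rightarrow> ('m \<Rightarrow> 'm \<Rightarrow> 'm) set" where
  "perm_systems A a = {t. t = tab A a t \<and>
     (\<forall>b c. \<forall>\<phi>\<in>arrows A b a. bij_betw (t \<phi>) (arrows A c b) (arrows A c b)) \<and>
     (\<forall>b c d. \<forall>\<phi>\<in>arrows A b a. \<forall>\<psi>\<in>arrows A c b. \<forall>\<chi>\<in>arrows A d c.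
        t \<phi> (Cmp A \<psi> \<chi>) = Cmp A (t \<phi> \<psi>) (t (Cmp A \<phi> \<psi>) \<chi>))}"

text \<open>\<open>t (Idn A a)\<close> is the action of the element itself on arrows into a.
  Multiplication is dictated by axiom (ii): over \<phi> the right factor acts by
  \<open>t \<phi>\<close>, and then the left factor by its component at the moved arrow
  \<open>t (Idn A a) \<phi>\<close>.\<close>

definition perm_crossed :: "('o, 'm) cat \<Rightarrow> ('o, 'm, 'm \<Rightarrow> 'm \<Rightarrow> 'm) crossed" where
  "perm_crossed A =
     \<lparr>grp = (\<lambda>a. \<lparr>carrier = perm_systems A a,
        mult = (\<lambda>s t. tab A a (\<lambda>\<phi> \<psi>. s (t (Idn A a) \<phi>) (t \<phi> \<psi>))),
        one = tab A a (\<lambda>\<phi> \<psi>. \<psi>)\<rparr>),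
      res = (\<lambda>\<alpha> t. tab A (Dom A \<alpha>) (\<lambda>\<phi>. t (Cmp A \<alpha> \<phi>))),
      act = (\<lambda>a b t. restrict (t (Idn A b)) (arrows A a b))\<rparr>"

section \<open>Group structure and restriction of compatible permutation families\<close>

context category
begin

lemma tab_apply [simp]: "\<lbrakk>\<phi> \<in> arrows C b a; \<psi> \<in> arrows C c b\<rbrakk> \<Longrightarrow> tab C a f \<phi> \<psi> = f \<phi> \<psi>"
  by (auto simp: tab_def)

lemma tab_eqI:
  "(\<And>b c \<phi> \<psi>. \<lbrakk>\<phi> \<in> arrows C b a; \<psi> \<in> arrows C c b\<rbrakk> \<Longrightarrow> f \<phi> \<psi> = g \<phi> \<psi>) \<Longrightarrow> tab C a f = tab C a g"
  by (fastforce simp: tab_def fun_eq_iff)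

lemma perm_systems_eqI:
  assumes "s \<in> perm_systems C a" "t \<in> perm_systems C a"
    and "\<And>b c \<phi> \<psi>. \<lbrakk>\<phi> \<in> arrows C b a; \<psi> \<in> arrows C c b\<rbrakk> \<Longrightarrow> s \<phi> \<psi> = t \<phi> \<psi>"
  shows "s = t"
  using assms tab_eqI[of a s t] by (simp add: perm_systems_def)

lemma perm_systems_bij:
  "\<lbrakk>t \<in> perm_systems C a; \<phi> \<in> arrows C b a\<rbrakk> \<Longrightarrow> bij_betw (t \<phi>) (arrows C c b) (arrows C c b)"
  by (auto simp: perm_systems_def)

lemma perm_systems_in:
  "\<lbrakk>t \<in> perm_systems C a; \<phi> \<in> arrows C b a; \<psi> \<in> arrows C c b\<rbrakk> \<Longrightarrow> t \<phi> \<psi> \<in> arrows C c b"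
  using perm_systems_bij bij_betwE by blast

lemma perm_systems_Cmp:
  "\<lbrakk>t \<in> perm_systems C a; \<phi> \<in> arrows C b a; \<psi> \<in> arrows C c b; \<chi> \<in> arrows C d c\<rbrakk>
    \<Longrightarrow> t \<phi> (Cmp C \<psi> \<chi>) = Cmp C (t \<phi> \<psi>) (t (Cmp C \<phi> \<psi>) \<chi>)"
  by (auto simp: perm_systems_def)

lemma tab_in_perm_systems:
  assumes bij: "\<And>b c \<phi>. \<phi> \<in> arrows C b a \<Longrightarrow> bij_betw (f \<phi>) (arrows C c b) (arrows C c b)"
    and Cmp: "\<And>b c d \<phi> \<psi> \<chi>. \<lbrakk>\<phi> \<in> arrows C b a; \<psi> \<in> arrows C c b; \<chi> \<in> arrows C d c\<rbrakk>
      \<Longrightarrow> f \<phi> (Cmp C \<psi> \<chi>) = Cmp C (f \<phi> \<psi>) (f (Cmp C \<phi> \<psi>) \<chi>)"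
  shows "tab C a f \<in> perm_systems C a"
proof -
  have "tab C a f = tab C a (tab C a f)"
    by (rule tab_eqI) simp
  moreover have "bij_betw (tab C a f \<phi>) (arrows C c b) (arrows C c b)" if "\<phi> \<in> arrows C b a" for b c \<phi>
    using bij[OF that] that by (subst bij_betw_cong[of _ _ "f \<phi>"]) auto
  moreover have "tab C a f \<phi> (Cmp C \<psi> \<chi>) = Cmp C (tab C a f \<phi> \<psi>) (tab C a f (Cmp C \<phi> \<psi>) \<chi>)"
    if "\<phi> \<in> arrows C b a" "\<psi> \<in> arrows C c b" "\<chi> \<in> arrows C d c" for b c d \<phi> \<psi> \<chi>
    using Cmp[OF that] that Cmp_in[OF that(2,1)] Cmp_in[OF that(3,2)] by simp
  ultimately show ?thesis unfolding perm_systems_def by blast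
qed

text \<open>As \<open>t \<phi>\<close> is onto, \<open>Idn C b\<close> is
  \<open>t \<phi> \<psi>\<close> for some \<psi>. Compatibility for the factorisation of \<psi>
  through the identity then writes \<open>Idn C b\<close> as \<open>t \<phi> (Idn C b)\<close> after
  \<open>Idn C b\<close>.\<close>

lemma perm_systems_Idn:
  assumes t: "t \<in> perm_systems C a" and \<phi>: "\<phi> \<in> arrows C b a"
  shows "t \<phi> (Idn C b) = Idn C b"
proof -
  have 1: "Idn C b \<in> arrows C b b" using arrows_Obj[OF \<phi>] Idn_in by blast
  obtain \<psi> where \<psi>: "\<psi> \<in> arrows C b b" "t \<phi> \<psi> = Idn C b"
    using perm_systems_bij[OF t \<phi>] 1 unfolding bij_betw_def by (metis imageE)
  have "t \<phi> \<psi> = Cmp C (t \<phi> (Idn C b)) (t \<phi> \<psi>)"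
    using perm_systems_Cmp[OF t \<phi> 1 \<psi>(1)] Idn_Cmp[OF \<psi>(1)] Cmp_Idn[OF \<phi>] by simp
  then show ?thesis
    using \<psi>(2) Cmp_Idn[OF perm_systems_in[OF t \<phi> 1]] by simp
qed

lemma perm_systems_Idn_Cmp:
  assumes "t \<in> perm_systems C a" "\<phi> \<in> arrows C b a" "\<psi> \<in> arrows C c b"
  shows "t (Idn C a) (Cmp C \<phi> \<psi>) = Cmp C (t (Idn C a) \<phi>) (t \<phi> \<psi>)"
  using perm_systems_Cmp[OF assms(1) _ assms(2,3), of "Idn C a"] Idn_Cmp assms(2) Idn_in arrows_Obj by simp

text \<open>Compatibility of \<open>t\<close>, then of \<open>s\<close>, leaves \<open>s\<close>
  indexed by a composite of moved arrows. By compatibility of \<open>t\<close> at the identity this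
  is the moved composite, as required.\<close>

lemma perm_systems_mult:
  assumes s: "s \<in> perm_systems C a" and t: "t \<in> perm_systems C a"
  shows "tab C a (\<lambda>\<phi> \<psi>. s (t (Idn C a) \<phi>) (t \<phi> \<psi>)) \<in> perm_systems C a"
proof (rule tab_in_perm_systems)
  fix b c \<phi> assume \<phi>: "\<phi> \<in> arrows C b a"
  have 1: "Idn C a \<in> arrows C a a" using arrows_Obj[OF \<phi>] Idn_in by blast
  note t\<phi> = perm_systems_in[OF t 1 \<phi>]
  show "bij_betw (\<lambda>\<psi>. s (t (Idn C a) \<phi>) (t \<phi> \<psi>)) (arrows C c b) (arrows C c b)"
    using bij_betw_trans[OF perm_systems_bij[OF t \<phi>, of c] perm_systems_bij[OF s t\<phi>, of c]]
    by (simp add: comp_def)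
  fix \<psi> d \<chi> assume \<psi>: "\<psi> \<in> arrows C c b" and \<chi>: "\<chi> \<in> arrows C d c"
  show "s (t (Idn C a) \<phi>) (t \<phi> (Cmp C \<psi> \<chi>)) =
    Cmp C (s (t (Idn C a) \<phi>) (t \<phi> \<psi>)) (s (t (Idn C a) (Cmp C \<phi> \<psi>)) (t (Cmp C \<phi> \<psi>) \<chi>))"
    using perm_systems_Cmp[OF t \<phi> \<psi> \<chi>] perm_systems_Idn_Cmp[OF t \<phi> \<psi>]
      perm_systems_Cmp[OF s t\<phi> perm_systems_in[OF t \<phi> \<psi>] perm_systems_in[OF t Cmp_in[OF \<psi> \<phi>] \<chi>]]
    by simp
qed

lemma perm_systems_one: "tab C a (\<lambda>\<phi> \<psi>. \<psi>) \<in> perm_systems C a"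
  by (rule tab_in_perm_systems) (auto simp: bij_betw_def)

lemma perm_systems_res:
  assumes \<alpha>: "\<alpha> \<in> arrows C a b" and t: "t \<in> perm_systems C b"
  shows "tab C a (\<lambda>\<phi>. t (Cmp C \<alpha> \<phi>)) \<in> perm_systems C a"
  by (rule tab_in_perm_systems)
    (use \<alpha> t in \<open>auto intro!: perm_systems_bij Cmp_in
      simp: perm_systems_Cmp[OF t Cmp_in] Cmp_assoc[of _ _ _ _ _ \<alpha>]\<close>)

text \<open>The equation determines the left inverse: \<open>s\<close> at the moved arrow
  \<open>t (Idn C a) \<phi>\<close> has to invert \<open>t \<phi>\<close>. Moving arrows is
  bijective, so each index is reached exactly once.\<close>

lemma perm_systems_inv:
  assumes t: "t \<in> perm_systems C a" and a: "a \<in> Obj C"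
  shows "\<exists>s\<in>perm_systems C a. tab C a (\<lambda>\<phi> \<psi>. s (t (Idn C a) \<phi>) (t \<phi> \<psi>)) = tab C a (\<lambda>\<phi> \<psi>. \<psi>)"
proof -
  have 1: "Idn C a \<in> arrows C a a" using a Idn_in by blast
  \<comment> \<open>\<open>u \<phi>\<close> is the arrow that \<open>t\<close> moves to \<phi>, so
    \<open>f \<phi>\<close> below inverts \<open>t (u \<phi>)\<close>.\<close>
  define u where "u \<phi> = inv_into (arrows C (Dom C \<phi>) a) (t (Idn C a)) \<phi>" for \<phi>
  define f where "f \<phi> \<psi> = inv_into (arrows C (Dom C \<psi>) (Dom C \<phi>)) (t (u \<phi>)) \<psi>" for \<phi> \<psi>
  have dom: "Dom C \<phi> = b" if "\<phi> \<in> arrows C b c" for \<phi> b c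
    using that by (simp add: arrows_def)
  have u: "u \<phi> \<in> arrows C b a" "t (Idn C a) (u \<phi>) = \<phi>" if "\<phi> \<in> arrows C b a" for \<phi> b
    using bij_betw_inv_into_right[OF perm_systems_bij[OF t 1] that]
      bij_betw_apply[OF bij_betw_inv_into[OF perm_systems_bij[OF t 1]] that] that
    by (simp_all add: u_def dom)
  have u': "u (t (Idn C a) \<phi>) = \<phi>" if "\<phi> \<in> arrows C b a" for \<phi> b
    using bij_betw_inv_into_left[OF perm_systems_bij[OF t 1] that] perm_systems_in[OF t 1 that] that
    by (simp add: u_def dom)
  have f: "f \<phi> \<psi> \<in> arrows C c b" "t (u \<phi>) (f \<phi> \<psi>) = \<psi>"
    if "\<phi> \<in> arrows C b a" "\<psi> \<in> arrows C c b" for \<phi> \<psi> b c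
    using bij_betw_inv_into_right[OF perm_systems_bij[OF t u(1)[OF that(1)]] that(2)]
      bij_betw_apply[OF bij_betw_inv_into[OF perm_systems_bij[OF t u(1)[OF that(1)]]] that(2)] that
    by (simp_all add: f_def dom)
  have f': "f \<phi> (t (u \<phi>) \<psi>) = \<psi>" if "\<phi> \<in> arrows C b a" "\<psi> \<in> arrows C c b" for \<phi> \<psi> b c
    using bij_betw_inv_into_left[OF perm_systems_bij[OF t u(1)[OF that(1)]] that(2)]
      perm_systems_in[OF t u(1)[OF that(1)] that(2)] that
    by (simp add: f_def dom)
  have s: "tab C a f \<in> perm_systems C a"
  proof (rule tab_in_perm_systems)
    fix b c \<phi> assume \<phi>: "\<phi> \<in> arrows C b a"
    show "bij_betw (f \<phi>) (arrows C c b) (arrows C c b)"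
      by (rule bij_betw_byWitness[where f' = "t (u \<phi>)"])
        (use f[OF \<phi>] f'[OF \<phi>] perm_systems_in[OF t u(1)[OF \<phi>]] in auto)
    fix \<psi> d \<chi> assume \<psi>: "\<psi> \<in> arrows C c b" and \<chi>: "\<chi> \<in> arrows C d c"
    \<comment> \<open>The composite is moved to \<open>Cmp C \<phi> \<psi>\<close>, hence it is
      \<open>u (Cmp C \<phi> \<psi>)\<close>. This supplies the index that compatibility of
      \<open>f\<close> asks for.\<close>
    have "t (Idn C a) (Cmp C (u \<phi>) (f \<phi> \<psi>)) = Cmp C \<phi> \<psi>"
      using perm_systems_Idn_Cmp[OF t u(1)[OF \<phi>] f(1)[OF \<phi> \<psi>]] u(2)[OF \<phi>] f(2)[OF \<phi> \<psi>] by simp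
    then have *: "u (Cmp C \<phi> \<psi>) = Cmp C (u \<phi>) (f \<phi> \<psi>)"
      using u'[OF Cmp_in[OF f(1)[OF \<phi> \<psi>] u(1)[OF \<phi>]]] by simp
    note f\<chi> = f[OF Cmp_in[OF \<psi> \<phi>] \<chi>]
    have "t (u \<phi>) (Cmp C (f \<phi> \<psi>) (f (Cmp C \<phi> \<psi>) \<chi>)) = Cmp C \<psi> \<chi>"
      using perm_systems_Cmp[OF t u(1)[OF \<phi>] f(1)[OF \<phi> \<psi>] f\<chi>(1)] f(2)[OF \<phi> \<psi>] f\<chi>(2) by (simp add: *)
    then show "f \<phi> (Cmp C \<psi> \<chi>) = Cmp C (f \<phi> \<psi>) (f (Cmp C \<phi> \<psi>) \<chi>)"
      using f'[OF \<phi> Cmp_in[OF f\<chi>(1) f(1)[OF \<phi> \<psi>]]] by simp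
  qed
  moreover have "tab C a (\<lambda>\<phi> \<psi>. tab C a f (t (Idn C a) \<phi>) (t \<phi> \<psi>)) = tab C a (\<lambda>\<phi> \<psi>. \<psi>)"
  proof (rule tab_eqI)
    fix b c \<phi> \<psi> assume \<phi>: "\<phi> \<in> arrows C b a" and \<psi>: "\<psi> \<in> arrows C c b"
    have "f (t (Idn C a) \<phi>) (t \<phi> \<psi>) = \<psi>"
      using f'[OF perm_systems_in[OF t 1 \<phi>] \<psi>] u'[OF \<phi>] by simp
    then show "tab C a f (t (Idn C a) \<phi>) (t \<phi> \<psi>) = \<psi>"
      using perm_systems_in[OF t 1 \<phi>] perm_systems_in[OF t \<phi> \<psi>] by simp
  qed
  ultimately show ?thesis by blast
qed

lemma crossed_group_perm_crossed: "crossed_group C (perm_crossed C)"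
proof (rule crossed_groupI)
  show "category C" by unfold_locales
next
  fix a b \<alpha> t assume \<alpha>: "\<alpha> \<in> arrows C a b" and t: "t \<in> carrier (grp (perm_crossed C) b)"
  note t = t[unfolded perm_crossed_def, simplified]
  have dom: "Dom C \<alpha> = a" using \<alpha> by (simp add: arrows_def)
  note [simp] = arrows_Obj[OF \<alpha>]
  have 1: "Idn C a \<in> arrows C a a" "Idn C b \<in> arrows C b b" using Idn_in by simp_all
  show "res (perm_crossed C) \<alpha> t \<in> carrier (grp (perm_crossed C) a)"
    using perm_systems_res[OF \<alpha> t] by (simp add: perm_crossed_def dom)
  show t\<alpha>: "act (perm_crossed C) a b t \<alpha> \<in> arrows C a b"
    using perm_systems_in[OF t 1(2) \<alpha>] \<alpha> by (simp add: perm_crossed_def)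
  fix s assume s: "s \<in> carrier (grp (perm_crossed C) b)"
  note s = s[unfolded perm_crossed_def, simplified]
  \<comment> \<open>The action evaluates a family at the identity, where the product has index
    \<open>s (Idn C b) (Idn C b)\<close>; \<open>perm_systems_Idn\<close> reduces it to
    \<open>Idn C b\<close>.\<close>
  show "act (perm_crossed C) a b (t \<otimes>\<^bsub>grp (perm_crossed C) b\<^esub> s) \<alpha> =
      act (perm_crossed C) a b t (act (perm_crossed C) a b s \<alpha>)"
    using \<alpha> 1(2) perm_systems_in[OF s 1(2) \<alpha>] perm_systems_Idn[OF s 1(2)]
    by (simp add: perm_crossed_def tab_apply[OF 1(2) \<alpha>])
  have s\<alpha>: "s (Idn C b) \<alpha> \<in> arrows C a b" using perm_systems_in[OF s 1(2) \<alpha>] .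
  then have dom': "Dom C (s (Idn C b) \<alpha>) = a" by (simp add: arrows_def)
  \<comment> \<open>Axiom (ii) in terms of families. On the left, \<open>t\<close> is indexed by the
    composite of \<alpha> and \<phi> moved by \<open>s\<close>; on the right, by the moved \<alpha>
    after \<phi> moved by the restriction of \<open>s\<close>. The two indices agree by
    \<open>perm_systems_Idn_Cmp\<close>.\<close>
  have "tab C a (\<lambda>\<phi>. tab C b (\<lambda>\<phi> \<psi>. t (s (Idn C b) \<phi>) (s \<phi> \<psi>)) (Cmp C \<alpha> \<phi>)) =
      tab C a (\<lambda>\<phi> \<psi>. tab C a (\<lambda>\<phi>. t (Cmp C (s (Idn C b) \<alpha>) \<phi>)) (tab C a (\<lambda>\<phi>. s (Cmp C \<alpha> \<phi>)) (Idn C a) \<phi>)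
        (tab C a (\<lambda>\<phi>. s (Cmp C \<alpha> \<phi>)) \<phi> \<psi>))"
  proof (rule tab_eqI)
    fix c d \<phi> \<psi> assume \<phi>: "\<phi> \<in> arrows C c a" and \<psi>: "\<psi> \<in> arrows C d c"
    note \<alpha>\<phi> = Cmp_in[OF \<phi> \<alpha>]
    show "tab C b (\<lambda>\<phi> \<psi>. t (s (Idn C b) \<phi>) (s \<phi> \<psi>)) (Cmp C \<alpha> \<phi>) \<psi> =
        tab C a (\<lambda>\<phi>. t (Cmp C (s (Idn C b) \<alpha>) \<phi>)) (tab C a (\<lambda>\<phi>. s (Cmp C \<alpha> \<phi>)) (Idn C a) \<phi>)
        (tab C a (\<lambda>\<phi>. s (Cmp C \<alpha> \<phi>)) \<phi> \<psi>)"
      using perm_systems_in[OF s \<alpha> \<phi>] perm_systems_in[OF s \<alpha>\<phi> \<psi>]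
      by (simp add: tab_apply[OF \<alpha>\<phi> \<psi>] tab_apply[OF 1(1) \<phi>] tab_apply[OF \<phi> \<psi>] Cmp_Idn[OF \<alpha>]
          perm_systems_Idn_Cmp[OF s \<alpha> \<phi>])
  qed
  then show "res (perm_crossed C) \<alpha> (t \<otimes>\<^bsub>grp (perm_crossed C) b\<^esub> s) =
      res (perm_crossed C) (act (perm_crossed C) a b s \<alpha>) t \<otimes>\<^bsub>grp (perm_crossed C) a\<^esub>
      res (perm_crossed C) \<alpha> s"
    using \<alpha> by (simp add: perm_crossed_def dom dom')
next
  fix a b c \<phi> \<psi> t
  assume \<phi>: "\<phi> \<in> arrows C a b" and \<psi>: "\<psi> \<in> arrows C b c" and t: "t \<in> carrier (grp (perm_crossed C) c)"
  note t = t[unfolded perm_crossed_def, simplified]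
  have dom: "Dom C \<phi> = a" "Dom C \<psi> = b" "Dom C (Cmp C \<psi> \<phi>) = a"
    using \<phi> \<psi> Cmp_in[OF \<phi> \<psi>] by (simp_all add: arrows_def)
  have 1: "Idn C b \<in> arrows C b b" using Idn_in arrows_Obj[OF \<phi>] by blast
  have "tab C a (\<lambda>\<chi>. t (Cmp C (Cmp C \<psi> \<phi>) \<chi>)) = tab C a (\<lambda>\<chi>. tab C b (\<lambda>\<phi>. t (Cmp C \<psi> \<phi>)) (Cmp C \<phi> \<chi>))"
    by (rule tab_eqI) (use \<phi> \<psi> in \<open>simp add: tab_apply[OF Cmp_in] Cmp_assoc\<close>)
  then show "res (perm_crossed C) (Cmp C \<psi> \<phi>) t = res (perm_crossed C) \<phi> (res (perm_crossed C) \<psi> t)"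
    by (simp add: perm_crossed_def dom)
  show "act (perm_crossed C) a c t (Cmp C \<psi> \<phi>) =
      Cmp C (act (perm_crossed C) b c t \<psi>) (act (perm_crossed C) a b (res (perm_crossed C) \<psi> t) \<phi>)"
    using \<phi> \<psi> Cmp_in[OF \<phi> \<psi>] perm_systems_Idn_Cmp[OF t \<psi> \<phi>]
    by (simp add: perm_crossed_def dom tab_apply[OF 1 \<phi>] Cmp_Idn[OF \<psi>])
next
  fix a t assume a: "a \<in> Obj C" and t: "t \<in> carrier (grp (perm_crossed C) a)"
  note t = t[unfolded perm_crossed_def, simplified]
  have 1: "Idn C a \<in> arrows C a a" using Idn_in a by blast
  then have dom: "Dom C (Idn C a) = a" by (simp add: arrows_def)
  have t_tab: "tab C a t = t" using t by (simp add: perm_systems_def)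
  have "tab C a (\<lambda>\<phi>. t (Cmp C (Idn C a) \<phi>)) = tab C a t"
    by (rule tab_eqI) (simp add: Idn_Cmp)
  then show "res (perm_crossed C) (Idn C a) t = t"
    by (simp add: perm_crossed_def dom t_tab)
  have "tab C a (\<lambda>\<phi> \<psi>. tab C a (\<lambda>\<phi> \<psi>. \<psi>) (t (Idn C a) \<phi>) (t \<phi> \<psi>)) = tab C a t"
    by (rule tab_eqI) (simp add: tab_apply[OF perm_systems_in[OF t 1] perm_systems_in[OF t]])
  then show "\<one>\<^bsub>grp (perm_crossed C) a\<^esub> \<otimes>\<^bsub>grp (perm_crossed C) a\<^esub> t = t"
    by (simp add: perm_crossed_def t_tab)
  show "\<exists>s\<in>carrier (grp (perm_crossed C) a). s \<otimes>\<^bsub>grp (perm_crossed C) a\<^esub> t = \<one>\<^bsub>grp (perm_crossed C) a\<^esub>"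
    using perm_systems_inv[OF t a] by (simp add: perm_crossed_def)
  fix s assume s: "s \<in> carrier (grp (perm_crossed C) a)"
  note s = s[unfolded perm_crossed_def, simplified]
  show "t \<otimes>\<^bsub>grp (perm_crossed C) a\<^esub> s \<in> carrier (grp (perm_crossed C) a)"
    using perm_systems_mult[OF t s] by (simp add: perm_crossed_def)
  fix r assume r: "r \<in> carrier (grp (perm_crossed C) a)"
  note r = r[unfolded perm_crossed_def, simplified]
  have "tab C a (\<lambda>\<phi> \<psi>. tab C a (\<lambda>\<phi> \<psi>. t (s (Idn C a) \<phi>) (s \<phi> \<psi>)) (r (Idn C a) \<phi>) (r \<phi> \<psi>)) =
      tab C a (\<lambda>\<phi> \<psi>. t (tab C a (\<lambda>\<phi> \<psi>. s (r (Idn C a) \<phi>) (r \<phi> \<psi>)) (Idn C a) \<phi>)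
        (tab C a (\<lambda>\<phi> \<psi>. s (r (Idn C a) \<phi>) (r \<phi> \<psi>)) \<phi> \<psi>))"
  proof (rule tab_eqI)
    fix b c \<phi> \<psi> assume \<phi>: "\<phi> \<in> arrows C b a" and \<psi>: "\<psi> \<in> arrows C c b"
    show "tab C a (\<lambda>\<phi> \<psi>. t (s (Idn C a) \<phi>) (s \<phi> \<psi>)) (r (Idn C a) \<phi>) (r \<phi> \<psi>) =
      t (tab C a (\<lambda>\<phi> \<psi>. s (r (Idn C a) \<phi>) (r \<phi> \<psi>)) (Idn C a) \<phi>)
        (tab C a (\<lambda>\<phi> \<psi>. s (r (Idn C a) \<phi>) (r \<phi> \<psi>)) \<phi> \<psi>)"
      by (simp add: tab_apply[OF perm_systems_in[OF r 1 \<phi>] perm_systems_in[OF r \<phi> \<psi>]]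
          tab_apply[OF 1 \<phi>] tab_apply[OF \<phi> \<psi>] perm_systems_Idn[OF r 1])
  qed
  then show "(t \<otimes>\<^bsub>grp (perm_crossed C) a\<^esub> s) \<otimes>\<^bsub>grp (perm_crossed C) a\<^esub> r =
      t \<otimes>\<^bsub>grp (perm_crossed C) a\<^esub> (s \<otimes>\<^bsub>grp (perm_crossed C) a\<^esub> r)"
    by (simp add: perm_crossed_def)
next
  fix a b \<phi> assume \<phi>: "\<phi> \<in> arrows C a b"
  have "Idn C b \<in> arrows C b b" using Idn_in arrows_Obj[OF \<phi>] by blast
  then show "act (perm_crossed C) a b \<one>\<^bsub>grp (perm_crossed C) b\<^esub> \<phi> = \<phi>"
    using \<phi> by (simp add: perm_crossed_def)
qed (simp_all add: perm_crossed_def perm_systems_one)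

text \<open>The family records how all restrictions of x act. Axiom (i) makes it compatible; axiom
  (ii) together with the action law makes it multiplicative.\<close>

lemma perm_crossed_terminal_ex:
  assumes "crossed_group C G"
  shows "crossed_hom C G (perm_crossed C)
    (\<lambda>a x. tab C a (\<lambda>\<phi> \<psi>. act G (Dom C \<psi>) (Dom C \<phi>) (res G \<phi> x) \<psi>))" (is "crossed_hom C G _ ?f")
proof -
  interpret G: crossed_group C G by fact
  have dom: "Dom C \<phi> = b" if "\<phi> \<in> arrows C b c" for \<phi> b c
    using that by (simp add: arrows_def)
  have f_apply: "?f a x \<phi> \<psi> = act G c b (res G \<phi> x) \<psi>"
    if "\<phi> \<in> arrows C b a" "\<psi> \<in> arrows C c b" for a b c x \<phi> \<psi>
    unfolding tab_apply[OF that] dom[OF that(1)] dom[OF that(2)] ..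
  show ?thesis
  proof (rule crossed_homI)
    fix a x assume a: "a \<in> Obj C" and x: "x \<in> carrier (grp G a)"
    have 1: "Idn C a \<in> arrows C a a" using Idn_in a by blast
    have "?f a x \<in> perm_systems C a"
    proof (rule tab_in_perm_systems)
      fix b c \<phi> assume \<phi>: "\<phi> \<in> arrows C b a"
      show "bij_betw (\<lambda>\<psi>. act G (Dom C \<psi>) (Dom C \<phi>) (res G \<phi> x) \<psi>) (arrows C c b) (arrows C c b)"
      \<comment> \<open>\<open>perm_systems\<close> quantifies over every c, while the action is
        known to be bijective only for objects; for any other c there are no arrows to
        permute.\<close>
      proof (cases "c \<in> Obj C")
        case True
        show ?thesis
          using G.act_bij[OF True _ G.res_in[OF \<phi> x]] arrows_Obj[OF \<phi>]
          by (subst bij_betw_cong[of _ _ "act G c b (res G \<phi> x)"]) (auto simp: dom dom[OF \<phi>])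
      next
        case False
        then have "arrows C c b = {}" using arrows_Obj by blast
        then show ?thesis by (simp add: bij_betw_def)
      qed
      fix \<psi> d \<chi> assume \<psi>: "\<psi> \<in> arrows C c b" and \<chi>: "\<chi> \<in> arrows C d c"
      show "act G (Dom C (Cmp C \<psi> \<chi>)) (Dom C \<phi>) (res G \<phi> x) (Cmp C \<psi> \<chi>) =
        Cmp C (act G (Dom C \<psi>) (Dom C \<phi>) (res G \<phi> x) \<psi>)
          (act G (Dom C \<chi>) (Dom C (Cmp C \<phi> \<psi>)) (res G (Cmp C \<phi> \<psi>) x) \<chi>)"
        by (simp add: dom[OF \<phi>] dom[OF \<psi>] dom[OF \<chi>] dom[OF Cmp_in[OF \<chi> \<psi>]] dom[OF Cmp_in[OF \<psi> \<phi>]]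
            G.act_Cmp[OF \<chi> \<psi> G.res_in[OF \<phi> x]] G.res_Cmp[OF \<psi> \<phi> x])
    qed
    then show "?f a x \<in> carrier (grp (perm_crossed C) a)" by (simp add: perm_crossed_def)
    fix y assume y: "y \<in> carrier (grp G a)"
    have "?f a (x \<otimes>\<^bsub>grp G a\<^esub> y) = tab C a (\<lambda>\<phi> \<psi>. ?f a x (?f a y (Idn C a) \<phi>) (?f a y \<phi> \<psi>))"
    proof (rule tab_eqI)
      fix b c \<phi> \<psi> assume \<phi>: "\<phi> \<in> arrows C b a" and \<psi>: "\<psi> \<in> arrows C c b"
      note y\<phi> = G.act_in[OF \<phi> y] and y\<psi> = G.act_in[OF \<psi> G.res_in[OF \<phi> y]]
      show "act G (Dom C \<psi>) (Dom C \<phi>) (res G \<phi> (x \<otimes>\<^bsub>grp G a\<^esub> y)) \<psi> =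
          ?f a x (?f a y (Idn C a) \<phi>) (?f a y \<phi> \<psi>)"
        unfolding f_apply[OF 1 \<phi>] f_apply[OF \<phi> \<psi>] G.res_Idn[OF a y] f_apply[OF y\<phi> y\<psi>]
          dom[OF \<phi>] dom[OF \<psi>] G.res_mult[OF \<phi> x y]
        using G.act_mult[OF \<psi> G.res_in[OF y\<phi> x] G.res_in[OF \<phi> y]] .
    qed
    then show "?f a (x \<otimes>\<^bsub>grp G a\<^esub> y) = ?f a x \<otimes>\<^bsub>grp (perm_crossed C) a\<^esub> ?f a y"
      by (simp add: perm_crossed_def)
  next
    fix a b \<alpha> x assume \<alpha>: "\<alpha> \<in> arrows C a b" and x: "x \<in> carrier (grp G b)"
    have 1: "Idn C b \<in> arrows C b b" using Idn_in arrows_Obj[OF \<alpha>] by blast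
    have "?f a (res G \<alpha> x) = tab C a (\<lambda>\<phi>. ?f b x (Cmp C \<alpha> \<phi>))"
    proof (rule tab_eqI)
      fix c d \<phi> \<psi> assume \<phi>: "\<phi> \<in> arrows C c a" and \<psi>: "\<psi> \<in> arrows C d c"
      show "act G (Dom C \<psi>) (Dom C \<phi>) (res G \<phi> (res G \<alpha> x)) \<psi> = ?f b x (Cmp C \<alpha> \<phi>) \<psi>"
        unfolding f_apply[OF Cmp_in[OF \<phi> \<alpha>] \<psi>] dom[OF \<phi>] dom[OF \<psi>] G.res_Cmp[OF \<phi> \<alpha> x] ..
    qed
    then show "?f a (res G \<alpha> x) = res (perm_crossed C) \<alpha> (?f b x)"
      by (simp add: perm_crossed_def dom[OF \<alpha>])
    show "act G a b x \<alpha> = act (perm_crossed C) a b (?f b x) \<alpha>"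
      using \<alpha> f_apply[OF 1 \<alpha>, of x] G.res_Idn[OF _ x] arrows_Obj[OF \<alpha>] by (simp add: perm_crossed_def)
  qed
qed

text \<open>A homomorphism h is forced: the component of \<open>h a x\<close> at \<phi> is the
  action of its restriction along \<phi>. That restriction is the image of
  \<open>res G \<phi> x\<close>, so it acts as \<open>res G \<phi> x\<close> does.\<close>

lemma perm_crossed_terminal_unique:
  assumes "crossed_group C G"
    and f: "crossed_hom C G (perm_crossed C) f" and g: "crossed_hom C G (perm_crossed C) g"
    and a: "a \<in> Obj C" and x: "x \<in> carrier (grp G a)"
  shows "f a x = g a x"
proof -
  interpret G: crossed_group C G by fact
  have *: "h a x \<phi> \<psi> = act G c b (res G \<phi> x) \<psi>"
    if h: "crossed_hom C G (perm_crossed C) h" and \<phi>: "\<phi> \<in> arrows C b a" and \<psi>: "\<psi> \<in> arrows C c b"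
    for h b c \<phi> \<psi>
  proof -
    have 1: "Idn C b \<in> arrows C b b" using Idn_in arrows_Obj[OF \<phi>] by blast
    have dom: "Dom C \<phi> = b" using \<phi> by (simp add: arrows_def)
    show ?thesis
      using crossed_homD(4)[OF h \<psi> G.res_in[OF \<phi> x]] crossed_homD(3)[OF h \<phi> x] \<psi>
        tab_apply[OF 1 \<psi>, of "\<lambda>\<phi>'. h a x (Cmp C \<phi> \<phi>')"] Cmp_Idn[OF \<phi>]
      by (simp add: perm_crossed_def dom)
  qed
  show ?thesis
    by (rule perm_systems_eqI[of _ a])
      (use crossed_homD(1)[OF f a x] crossed_homD(1)[OF g a x] *[OF f] *[OF g] in
        \<open>auto simp: perm_crossed_def\<close>)
qed

end


section \<open>Sizes\<close>

text \<open>\<open>sets\<close> speaks only of subsets of the universe type. Embeddability extends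
  the bound to tuples, words and permutation families, which have types of their own.\<close>

definition set_sized :: "('u set \<Rightarrow> bool) \<Rightarrow> 'y set \<Rightarrow> bool" where
  "set_sized sets X \<longleftrightarrow> (\<exists>Y. sets Y \<and> X \<lesssim> Y)"

lemma set_sized_lepoll: "\<lbrakk>set_sized sets X; Y \<lesssim> X\<rbrakk> \<Longrightarrow> set_sized sets Y"
  unfolding set_sized_def by (meson lepoll_trans)

lemma set_sized_subset: "\<lbrakk>set_sized sets X; Y \<subseteq> X\<rbrakk> \<Longrightarrow> set_sized sets Y"
  by (meson set_sized_lepoll subset_imp_lepoll)

lemma set_sized_self: "sets X \<Longrightarrow> set_sized sets X"
  unfolding set_sized_def by blast

context size_universe
begin

lemma set_sized_eqpoll:
  assumes "set_sized sets X"
  shows "\<exists>Y. sets Y \<and> Y \<approx> X"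
proof -
  obtain Y f where Y: "sets Y" "inj_on f X" "f ` X \<subseteq> Y"
    using assms unfolding set_sized_def lepoll_def by blast
  then have "sets (f ` X)" by (meson sets_lepoll subset_imp_lepoll)
  then show ?thesis using inj_on_image_eqpoll_self[OF Y(2)] by blast
qed

lemma set_sized_PiE:
  assumes "small I" "\<And>i. i \<in> I \<Longrightarrow> set_sized sets (S i)"
  shows "set_sized sets (Pi\<^sub>E I S)"
proof -
  obtain Y where Y: "\<And>i. i \<in> I \<Longrightarrow> sets (Y i)" "\<And>i. i \<in> I \<Longrightarrow> S i \<lesssim> Y i"
    using assms(2) unfolding set_sized_def by metis
  obtain Z where Z: "sets Z" "Z \<approx> Pi\<^sub>E I Y" using sets_PiE[OF assms(1), of Y] Y(1) by blast
  have "Pi\<^sub>E I S \<lesssim> Z"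
    using lepoll_trans2[OF lepoll_PiE[of I S Y] eqpoll_sym[OF Z(2)]] Y(2) by blast
  then show ?thesis using Z(1) unfolding set_sized_def by blast
qed

lemma set_sized_Sigma:
  assumes "small I" "\<And>i. i \<in> I \<Longrightarrow> set_sized sets (S i)"
  shows "set_sized sets (Sigma I S)"
proof -
  obtain Y where Y: "\<And>i. i \<in> I \<Longrightarrow> sets (Y i)" "\<And>i. i \<in> I \<Longrightarrow> S i \<lesssim> Y i"
    using assms(2) unfolding set_sized_def by metis
  obtain Z where Z: "sets Z" "Z \<approx> Sigma I Y" using sets_Sigma[OF assms(1), of Y] Y(1) by blast
  have "Sigma I S \<lesssim> Sigma I Y" by (rule Sigma_lepoll_mono) (use Y(2) in auto)
  then have "Sigma I S \<lesssim> Z" using lepoll_trans2[OF _ eqpoll_sym[OF Z(2)]] by blast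
  then show ?thesis using Z(1) unfolding set_sized_def by blast
qed

lemma small_countable_infinite: "\<exists>e :: nat \<Rightarrow> 'u. inj e \<and> small (range e)"
proof -
  obtain X where X: "small X" "infinite X" using small_infinite by blast
  then obtain e :: "nat \<Rightarrow> 'u" where e: "inj e" "range e \<subseteq> X"
    using infinite_countable_subset by blast
  then have "small (range e)" by (meson X(1) small_lepoll subset_imp_lepoll)
  then show ?thesis using e by blast
qed

text \<open>\<open>sets_Sigma\<close> needs a small index set, and X need not be small. Instead a
  pair becomes a function on a small infinite set, with x at one point and y at all others; the sum
  type gives both kinds of values one type.\<close>

lemma set_sized_Times:
  assumes "set_sized sets X" "set_sized sets Y"
  shows "set_sized sets (X \<times> Y)"
proof -
  obtain e :: "nat \<Rightarrow> 'u" where e: "inj e" "small (range e)" using small_countable_infinite by blast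
  let ?S = "\<lambda>i. if i = e 0 then Inl ` X else Inr ` Y"
  have "set_sized sets (Pi\<^sub>E (range e) ?S)"
    by (rule set_sized_PiE) (auto intro: e set_sized_lepoll[OF assms(1)] set_sized_lepoll[OF assms(2)] image_lepoll)
  moreover have "X \<times> Y \<lesssim> Pi\<^sub>E (range e) ?S"
  proof -
    let ?f = "\<lambda>(x, y). \<lambda>i\<in>range e. if i = e 0 then Inl x else Inr y"
    have f: "?f p (e 0) = Inl (fst p)" "?f p (e 1) = Inr (snd p)" for p
      using e(1) by (auto simp: inj_eq split: prod.split)
    have "inj_on ?f (X \<times> Y)"
    proof (rule inj_onI)
      fix p q assume eq: "?f p = ?f q"
      show "p = q"
        using fun_cong[OF eq, of "e 0"] fun_cong[OF eq, of "e 1"]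
        unfolding f by (simp add: prod_eq_iff)
    qed
    moreover have "?f ` (X \<times> Y) \<subseteq> Pi\<^sub>E (range e) ?S" by auto
    ultimately show ?thesis unfolding lepoll_def by blast
  qed
  ultimately show ?thesis by (rule set_sized_lepoll)
qed

text \<open>A list is encoded by its length and its entries, padded to a sequence by a fixed element
  of X. Lengths and positions are indexed by a small copy of the naturals.\<close>

lemma set_sized_lists:
  assumes "set_sized sets X"
  shows "set_sized sets (lists X)"
proof (cases "X = {}")
  case True
  obtain e :: "nat \<Rightarrow> 'u" where "small (range e)" using small_countable_infinite by blast
  then have "set_sized sets (range e)" by (intro set_sized_self small_sets)
  moreover have "lists X \<lesssim> range e" using True by (auto simp: lepoll_def intro!: exI[of _ "\<lambda>_. e 0"])
  ultimately show ?thesis by (rule set_sized_lepoll)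
next
  case False
  then obtain x\<^sub>0 where x0: "x\<^sub>0 \<in> X" by blast
  obtain e :: "nat \<Rightarrow> 'u" where e: "inj e" "small (range e)" using small_countable_infinite by blast
  let ?f = "\<lambda>xs. (e (length xs), \<lambda>n\<in>range e. if inv_into UNIV e n < length xs then xs ! inv_into UNIV e n else x\<^sub>0)"
  have "inj_on ?f (lists X)"
  proof (rule inj_onI)
    fix xs ys assume eq: "?f xs = ?f ys"
    have len: "length xs = length ys" using eq e(1) by (simp add: inj_eq)
    have "xs ! n = ys ! n" if "n < length xs" for n
      using fun_cong[OF arg_cong[OF eq, of snd], of "e n"] that len e(1) by simp
    then show "xs = ys" using len by (simp add: nth_equalityI)
  qed
  moreover have "?f ` lists X \<subseteq> Sigma (range e) (\<lambda>_. Pi\<^sub>E (range e) (\<lambda>_. X))"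
    using x0 by (auto simp: in_lists_conv_set)
  ultimately have "lists X \<lesssim> Sigma (range e) (\<lambda>_. Pi\<^sub>E (range e) (\<lambda>_. X))"
    unfolding lepoll_def by blast
  moreover have "set_sized sets (Sigma (range e) (\<lambda>_. Pi\<^sub>E (range e) (\<lambda>_. X)))"
    by (intro set_sized_Sigma set_sized_PiE e assms)
  ultimately show ?thesis by (meson set_sized_lepoll)
qed

lemma set_sized_perm_systems:
  assumes "category C" "small (Arr C)"
  shows "set_sized sets (perm_systems C a)"
proof -
  interpret category C by fact
  \<comment> \<open>Values that are not arrows are replaced by \<phi> to stay inside
    \<open>Arr C\<close>. On composable pairs, which determine a system, nothing is changed.\<close>
  let ?f = "\<lambda>t. \<lambda>\<phi>\<in>Arr C. \<lambda>\<psi>\<in>Arr C. if t \<phi> \<psi> \<in> Arr C then t \<phi> \<psi> else \<phi>"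
  have "inj_on ?f (perm_systems C a)"
  proof (rule inj_onI)
    fix s t assume s: "s \<in> perm_systems C a" and t: "t \<in> perm_systems C a" and eq: "?f s = ?f t"
    show "s = t"
    proof (rule perm_systems_eqI[OF s t])
      fix b c \<phi> \<psi> assume *: "\<phi> \<in> arrows C b a" "\<psi> \<in> arrows C c b"
      then have "\<phi> \<in> Arr C" "\<psi> \<in> Arr C" "s \<phi> \<psi> \<in> Arr C" "t \<phi> \<psi> \<in> Arr C"
        using perm_systems_in[OF s *] perm_systems_in[OF t *] by (simp_all add: arrows_def)
      then show "s \<phi> \<psi> = t \<phi> \<psi>" using fun_cong[OF fun_cong[OF eq, of \<phi>], of \<psi>] by simp
    qed
  qed
  moreover have "?f ` perm_systems C a \<subseteq> Pi\<^sub>E (Arr C) (\<lambda>_. Pi\<^sub>E (Arr C) (\<lambda>_. Arr C))" by auto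
  ultimately have "perm_systems C a \<lesssim> Pi\<^sub>E (Arr C) (\<lambda>_. Pi\<^sub>E (Arr C) (\<lambda>_. Arr C))"
    unfolding lepoll_def by blast
  moreover have "set_sized sets (Pi\<^sub>E (Arr C) (\<lambda>_. Pi\<^sub>E (Arr C) (\<lambda>_. Arr C)))"
    by (intro set_sized_PiE set_sized_self small_sets assms)
  ultimately show ?thesis by (meson set_sized_lepoll)
qed

end

section \<open>Arrows of the category of crossed groups\<close>

lemma Obj_CrsGrp:
  "G \<in> Obj (CrsGrp sets A) \<longleftrightarrow> crossed_group A G \<and> (\<forall>a\<in>Obj A. sets (carrier (grp G a)))"
  by (simp add: CrsGrp_def Let_def)

definition mor :: "'g \<times> ('o \<Rightarrow> 'x \<Rightarrow> 'x) \<times> 'g \<Rightarrow> 'o \<Rightarrow> 'x \<Rightarrow> 'x" where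
  "mor f = fst (snd f)"

definition arrow_of :: "('o, 'm) cat \<Rightarrow> ('o, 'm, 'x) crossed \<Rightarrow> ('o \<Rightarrow> 'x \<Rightarrow> 'x) \<Rightarrow> ('o, 'm, 'x) crossed
    \<Rightarrow> ('o, 'm, 'x) crossed \<times> ('o \<Rightarrow> 'x \<Rightarrow> 'x) \<times> ('o, 'm, 'x) crossed" where
  "arrow_of A G f H = (G, \<lambda>a\<in>Obj A. \<lambda>x\<in>carrier (grp G a). f a x, H)"

lemma mor_arrow_of [simp]:
  "\<lbrakk>a \<in> Obj A; x \<in> carrier (grp G a)\<rbrakk> \<Longrightarrow> mor (arrow_of A G f H) a x = f a x"
  by (simp add: mor_def arrow_of_def)

lemma arrow_of_in:
  assumes "G \<in> Obj (CrsGrp sets A)" "H \<in> Obj (CrsGrp sets A)" "crossed_hom A G H f"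
  shows "arrow_of A G f H \<in> arrows (CrsGrp sets A) G H"
  using assms crossed_maps_restrict[of A G H f] by (auto simp: arrows_CrsGrp arrow_of_def Obj_CrsGrp)

lemma arrows_CrsGrpD:
  assumes "f \<in> arrows (CrsGrp sets A) G H"
  shows "G \<in> Obj (CrsGrp sets A)" "H \<in> Obj (CrsGrp sets A)" "crossed_hom A G H (mor f)"
  using assms by (auto simp: arrows_CrsGrp crossed_maps_iff mor_def)

lemma arrows_CrsGrp_eqI:
  assumes "f \<in> arrows (CrsGrp sets A) G H" "g \<in> arrows (CrsGrp sets A) G H"
    and eq: "\<And>a x. \<lbrakk>a \<in> Obj A; x \<in> carrier (grp G a)\<rbrakk> \<Longrightarrow> mor f a x = mor g a x"
  shows "f = g"
proof -
  obtain \<alpha> \<beta> where f: "f = (G, \<alpha>, H)" "\<alpha> \<in> crossed_maps A G H"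
    and g: "g = (G, \<beta>, H)" "\<beta> \<in> crossed_maps A G H"
    using assms(1,2) by (auto simp: arrows_CrsGrp)
  have "\<alpha> = \<beta>"
  proof (rule PiE_ext[of _ "Obj A" "\<lambda>a. carrier (grp G a) \<rightarrow>\<^sub>E carrier (grp H a)"])
    fix a assume a: "a \<in> Obj A"
    show "\<alpha> a = \<beta> a"
      by (rule PiE_ext[of _ "carrier (grp G a)" "\<lambda>_. carrier (grp H a)"])
        (use f g a eq in \<open>auto simp: crossed_maps_iff PiE_iff mor_def\<close>)
  qed (use f g in \<open>auto simp: crossed_maps_iff\<close>)
  then show ?thesis by (simp add: f g)
qed

lemma mor_Cmp:
  assumes "f \<in> arrows (CrsGrp sets A) G H" "a \<in> Obj A" "x \<in> carrier (grp G a)"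
  shows "mor (Cmp (CrsGrp sets A) g f) a x = mor g a (mor f a x)"
proof -
  obtain \<alpha> where f: "f = (G, \<alpha>, H)" using assms(1) by (auto simp: arrows_CrsGrp)
  show ?thesis using assms(2,3) by (cases g) (simp add: f CrsGrp_def Let_def mor_def compose_def)
qed

text \<open>Turns the commuting triangles of cones and cocones into equations of elements.\<close>

lemma Cmp_CrsGrp_eq_iff:
  assumes "f \<in> arrows (CrsGrp sets A) G H" "g \<in> arrows (CrsGrp sets A) H K"
    "h \<in> arrows (CrsGrp sets A) G K"
  shows "Cmp (CrsGrp sets A) g f = h \<longleftrightarrow>
    (\<forall>a\<in>Obj A. \<forall>x\<in>carrier (grp G a). mor g a (mor f a x) = mor h a x)"
proof -
  have "Cmp (CrsGrp sets A) g f \<in> arrows (CrsGrp sets A) G K"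
    using category.Cmp_in[OF category_CrsGrp assms(1,2)] .
  then show ?thesis
    using arrows_CrsGrp_eqI[OF _ assms(3)] mor_Cmp[OF assms(1)] by metis
qed

section \<open>Replacing a carrier by a set of the universe\<close>

text \<open>A crossed group whose elements lie in another type enters \<open>CrsGrp\<close> through
  an isomorphic copy. The structure is conjugated along bijections \<open>d\<close>, and the axioms
  are those of \<open>G\<close> seen through \<open>d\<close>.\<close>

lemma (in size_universe) crossed_group_transport:
  fixes G :: "('o, 'm, 'y) crossed"
  assumes "crossed_group A G" and "\<And>a. a \<in> Obj A \<Longrightarrow> set_sized sets (carrier (grp G a))"
  shows "\<exists>H d e. H \<in> Obj (CrsGrp sets A) \<and> crossed_hom A H G d \<and> crossed_hom A G H e \<and>
    (\<forall>a\<in>Obj A. \<forall>x\<in>carrier (grp H a). e a (d a x) = x) \<and>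
    (\<forall>a\<in>Obj A. \<forall>x\<in>carrier (grp G a). d a (e a x) = x)"
proof -
  interpret crossed_group A G by fact
  have "\<forall>a\<in>Obj A. \<exists>K d. sets K \<and> bij_betw d K (carrier (grp G a))"
    using set_sized_eqpoll[OF assms(2)] unfolding eqpoll_def by blast
  then obtain K d where K: "\<And>a. a \<in> Obj A \<Longrightarrow> sets (K a)"
    and d: "\<And>a. a \<in> Obj A \<Longrightarrow> bij_betw (d a) (K a) (carrier (grp G a))"
    by metis
  define e where "e a = inv_into (K a) (d a)" for a
  have ed: "e a (d a x) = x" "d a x \<in> carrier (grp G a)" if "a \<in> Obj A" "x \<in> K a" for a x
    using bij_betw_inv_into_left[OF d that(2)] bij_betw_apply[OF d that(2)] that by (auto simp: e_def)
  have de: "d a (e a x) = x" "e a x \<in> K a" if "a \<in> Obj A" "x \<in> carrier (grp G a)" for a x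
    using bij_betw_inv_into_right[OF d that(2)] bij_betw_apply[OF bij_betw_inv_into[OF d] that(2)] that
    by (auto simp: e_def)
  \<comment> \<open>\<open>res\<close> receives only the arrow, so \<open>Dom\<close> and
    \<open>Cod\<close> supply the objects at which to conjugate.\<close>
  define H where "H = \<lparr>grp = (\<lambda>a. \<lparr>carrier = K a, mult = (\<lambda>x y. e a (d a x \<otimes>\<^bsub>grp G a\<^esub> d a y)),
      one = e a \<one>\<^bsub>grp G a\<^esub>\<rparr>), res = (\<lambda>\<phi> x. e (Dom A \<phi>) (res G \<phi> (d (Cod A \<phi>) x))),
      act = (\<lambda>a b x. act G a b (d b x))\<rparr>"
  have H [simp]: "carrier (grp H a) = K a" "x \<otimes>\<^bsub>grp H a\<^esub> y = e a (d a x \<otimes>\<^bsub>grp G a\<^esub> d a y)"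
    "\<one>\<^bsub>grp H a\<^esub> = e a \<one>\<^bsub>grp G a\<^esub>" "act H a b x = act G a b (d b x)" for a b x y
    by (simp_all add: H_def)
  have res_H: "res H \<phi> x = e a (res G \<phi> (d b x))" if "\<phi> \<in> arrows A a b" for a b \<phi> x
    using that by (simp add: H_def arrows_def)
  have hom: "crossed_hom A H G d"
    by (rule crossed_homI) (simp_all add: res_H arrows_Obj ed de mult_in res_in)
  have "crossed_group A H"
  proof (rule crossed_group_jointly_embedded[where Q = "{(G, d)}"])
    fix a x y assume *: "a \<in> Obj A" "x \<in> carrier (grp H a)" "y \<in> carrier (grp H a)"
    show "x = y" if "\<And>M f. (M, f) \<in> {(G, d)} \<Longrightarrow> f a x = f a y"
      using that[of G d] ed * by (metis H(1) singletonI)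
    show "\<exists>y\<in>carrier (grp H a). \<forall>(M, f)\<in>{(G, d)}. f a y = inv\<^bsub>grp M a\<^esub> f a x"
      by (rule bexI[of _ "e a (inv\<^bsub>grp G a\<^esub> d a x)"]) (use de inv_in ed * in auto)
  qed (use hom ed de in \<open>auto simp: res_H arrows_Obj mult_in one_in res_in act_ext assms(1) category_axioms\<close>)
  moreover have "crossed_hom A G H e"
    by (rule crossed_homI) (simp_all add: res_H arrows_Obj ed de mult_in res_in)
  ultimately show ?thesis
    by (intro exI[of _ H] exI[of _ d] exI[of _ e]) (use hom ed de K in \<open>simp add: Obj_CrsGrp\<close>)
qed

text \<open>\<open>L\<close> may live in any type, and its universal property is tested only against
  objects of \<open>CrsGrp\<close>. The limit itself is the copy of \<open>L\<close> in the
  universe: projections are composed with \<open>d\<close>, factorisations with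
  \<open>e\<close>.\<close>

lemma (in size_universe) limit_CrsGrpI:
  fixes L :: "('o, 'm, 'y) crossed" and A :: "('o, 'm) cat"
  assumes F: "is_functor J (CrsGrp sets A) F\<^sub>o F\<^sub>a"
    and L: "crossed_group A L" "\<And>a. a \<in> Obj A \<Longrightarrow> set_sized sets (carrier (grp L a))"
    and p: "\<And>i. i \<in> Obj J \<Longrightarrow> crossed_hom A L (F\<^sub>o i) (p i)"
    and pF: "\<And>u i k a x. \<lbrakk>u \<in> arrows J i k; a \<in> Obj A; x \<in> carrier (grp L a)\<rbrakk>
      \<Longrightarrow> mor (F\<^sub>a u) a (p i a x) = p k a x"
    and ex: "\<And>M q. \<lbrakk>M \<in> Obj (CrsGrp sets A); \<And>i. i \<in> Obj J \<Longrightarrow> crossed_hom A M (F\<^sub>o i) (q i);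
        \<And>u i k a x. \<lbrakk>u \<in> arrows J i k; a \<in> Obj A; x \<in> carrier (grp M a)\<rbrakk>
          \<Longrightarrow> mor (F\<^sub>a u) a (q i a x) = q k a x\<rbrakk>
      \<Longrightarrow> \<exists>h. crossed_hom A M L h \<and>
        (\<forall>i\<in>Obj J. \<forall>a\<in>Obj A. \<forall>x\<in>carrier (grp M a). p i a (h a x) = q i a x)"
    and unique: "\<And>M g h a x. \<lbrakk>M \<in> Obj (CrsGrp sets A); crossed_hom A M L g; crossed_hom A M L h;
        \<And>i a x. \<lbrakk>i \<in> Obj J; a \<in> Obj A; x \<in> carrier (grp M a)\<rbrakk> \<Longrightarrow> p i a (g a x) = p i a (h a x);
        a \<in> Obj A; x \<in> carrier (grp M a)\<rbrakk> \<Longrightarrow> g a x = h a x"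
  shows "\<exists>L p. is_limit J (CrsGrp sets A) F\<^sub>o F\<^sub>a L p"
proof -
  interpret F: is_functor J "CrsGrp sets A" F\<^sub>o F\<^sub>a by fact
  interpret L: crossed_group A L by fact
  obtain H d e where H: "H \<in> Obj (CrsGrp sets A)" and d: "crossed_hom A H L d"
    and e: "crossed_hom A L H e"
    and ed: "\<And>a x. \<lbrakk>a \<in> Obj A; x \<in> carrier (grp H a)\<rbrakk> \<Longrightarrow> e a (d a x) = x"
    and de: "\<And>a x. \<lbrakk>a \<in> Obj A; x \<in> carrier (grp L a)\<rbrakk> \<Longrightarrow> d a (e a x) = x"
    using crossed_group_transport[OF L] by blast
  define P where "P i = arrow_of A H (\<lambda>a x. p i a (d a x)) (F\<^sub>o i)" for i
  have P: "P i \<in> arrows (CrsGrp sets A) H (F\<^sub>o i)" if "i \<in> Obj J" for i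
    unfolding P_def using H F.Obj_map[OF that] crossed_hom_comp[OF L.category_axioms d p[OF that]]
    by (rule arrow_of_in)
  have mor_P: "mor (P i) a x = p i a (d a x)" if "a \<in> Obj A" "x \<in> carrier (grp H a)" for i a x
    using that by (simp add: P_def)
  have arrows_J: "u \<in> arrows J (Dom J u) (Cod J u)" if "u \<in> Arr J" for u
    using that by (simp add: arrows_def)
  have "is_cone J (CrsGrp sets A) F\<^sub>o F\<^sub>a H P"
    unfolding is_cone_def
  proof (intro conjI ballI H P)
    fix u assume "u \<in> Arr J"
    then have u: "u \<in> arrows J (Dom J u) (Cod J u)" by (rule arrows_J)
    show "Cmp (CrsGrp sets A) (F\<^sub>a u) (P (Dom J u)) = P (Cod J u)"
      using Cmp_CrsGrp_eq_iff[OF P F.Arr_map[OF u] P] F.J.arrows_Obj[OF u] pF[OF u] mor_P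
        crossed_homD(1)[OF d] by simp
  qed
  moreover have "\<exists>!h. h \<in> arrows (CrsGrp sets A) M H \<and> (\<forall>i\<in>Obj J. Cmp (CrsGrp sets A) (P i) h = q i)"
    if cone: "is_cone J (CrsGrp sets A) F\<^sub>o F\<^sub>a M q" for M q
  proof -
    have M: "M \<in> Obj (CrsGrp sets A)" and q: "\<And>i. i \<in> Obj J \<Longrightarrow> q i \<in> arrows (CrsGrp sets A) M (F\<^sub>o i)"
      using cone by (auto simp: is_cone_def)
    have qF: "mor (F\<^sub>a u) a (mor (q i) a x) = mor (q k) a x"
      if u: "u \<in> arrows J i k" and "a \<in> Obj A" "x \<in> carrier (grp M a)" for u i k a x
    proof -
      have "Cmp (CrsGrp sets A) (F\<^sub>a u) (q i) = q k"
        using cone u by (auto simp: is_cone_def arrows_def)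
      then show ?thesis
        using Cmp_CrsGrp_eq_iff[OF q F.Arr_map[OF u] q] F.J.arrows_Obj[OF u] that by blast
    qed
    have Cmp_P: "Cmp (CrsGrp sets A) (P i) h = q i \<longleftrightarrow>
        (\<forall>a\<in>Obj A. \<forall>x\<in>carrier (grp M a). p i a (d a (mor h a x)) = mor (q i) a x)"
      if "i \<in> Obj J" "h \<in> arrows (CrsGrp sets A) M H" for i h
      using Cmp_CrsGrp_eq_iff[OF that(2) P q] that mor_P
        crossed_homD(1)[OF arrows_CrsGrpD(3)[OF that(2)]] by simp
    obtain h where h: "crossed_hom A M L h"
      and ph: "\<And>i a x. \<lbrakk>i \<in> Obj J; a \<in> Obj A; x \<in> carrier (grp M a)\<rbrakk> \<Longrightarrow> p i a (h a x) = mor (q i) a x"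
      using ex[OF M arrows_CrsGrpD(3)[OF q] qF] by blast
    define h' where "h' = arrow_of A M (\<lambda>a x. e a (h a x)) H"
    have h': "h' \<in> arrows (CrsGrp sets A) M H"
      unfolding h'_def using M H crossed_hom_comp[OF L.category_axioms h e] by (rule arrow_of_in)
    show ?thesis
    proof (rule ex1I[of _ h'])
      show "h' \<in> arrows (CrsGrp sets A) M H \<and> (\<forall>i\<in>Obj J. Cmp (CrsGrp sets A) (P i) h' = q i)"
        using h' by (simp add: Cmp_P ph h'_def de crossed_homD(1)[OF h])
      fix g assume g: "g \<in> arrows (CrsGrp sets A) M H \<and> (\<forall>i\<in>Obj J. Cmp (CrsGrp sets A) (P i) g = q i)"
      then have g_in: "g \<in> arrows (CrsGrp sets A) M H" by blast
      note g_hom = arrows_CrsGrpD(3)[OF g_in]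
      \<comment> \<open>Uniqueness is available only in \<open>L\<close>, so g is compared there
        after applying \<open>d\<close>; \<open>e\<close> cancels \<open>d\<close>
        afterwards.\<close>
      have dg: "d a (mor g a x) = h a x" if "a \<in> Obj A" "x \<in> carrier (grp M a)" for a x
      proof (rule unique[OF M crossed_hom_comp[OF L.category_axioms g_hom d] h _ that])
        fix i a x assume *: "i \<in> Obj J" "a \<in> Obj A" "x \<in> carrier (grp M a)"
        show "p i a (d a (mor g a x)) = p i a (h a x)" using Cmp_P[OF *(1) g_in] g * ph[OF *] by simp
      qed
      show "g = h'"
      proof (rule arrows_CrsGrp_eqI[OF g_in h'])
        fix a x assume "a \<in> Obj A" "x \<in> carrier (grp M a)"
        then show "mor g a x = mor h' a x"
          using ed[OF _ crossed_homD(1)[OF g_hom]] dg by (simp add: h'_def) 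
      qed
    qed
  qed
  ultimately show ?thesis unfolding is_limit_def by blast
qed

text \<open>Dually to \<open>limit_CrsGrpI\<close>, coprojections are composed with \<open>e\<close>
  and factorisations with \<open>d\<close>.\<close>

lemma (in size_universe) colimit_CrsGrpI:
  fixes L :: "('o, 'm, 'y) crossed" and A :: "('o, 'm) cat"
  assumes F: "is_functor J (CrsGrp sets A) F\<^sub>o F\<^sub>a"
    and L: "crossed_group A L" "\<And>a. a \<in> Obj A \<Longrightarrow> set_sized sets (carrier (grp L a))"
    and p: "\<And>i. i \<in> Obj J \<Longrightarrow> crossed_hom A (F\<^sub>o i) L (p i)"
    and pF: "\<And>u i k a x. \<lbrakk>u \<in> arrows J i k; a \<in> Obj A; x \<in> carrier (grp (F\<^sub>o i) a)\<rbrakk>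
      \<Longrightarrow> p k a (mor (F\<^sub>a u) a x) = p i a x"
    and ex: "\<And>M q. \<lbrakk>M \<in> Obj (CrsGrp sets A); \<And>i. i \<in> Obj J \<Longrightarrow> crossed_hom A (F\<^sub>o i) M (q i);
        \<And>u i k a x. \<lbrakk>u \<in> arrows J i k; a \<in> Obj A; x \<in> carrier (grp (F\<^sub>o i) a)\<rbrakk>
          \<Longrightarrow> q k a (mor (F\<^sub>a u) a x) = q i a x\<rbrakk>
      \<Longrightarrow> \<exists>h. crossed_hom A L M h \<and>
        (\<forall>i\<in>Obj J. \<forall>a\<in>Obj A. \<forall>x\<in>carrier (grp (F\<^sub>o i) a). h a (p i a x) = q i a x)"
    and unique: "\<And>M g h a x. \<lbrakk>M \<in> Obj (CrsGrp sets A); crossed_hom A L M g; crossed_hom A L M h;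
        \<And>i a x. \<lbrakk>i \<in> Obj J; a \<in> Obj A; x \<in> carrier (grp (F\<^sub>o i) a)\<rbrakk> \<Longrightarrow> g a (p i a x) = h a (p i a x);
        a \<in> Obj A; x \<in> carrier (grp L a)\<rbrakk> \<Longrightarrow> g a x = h a x"
  shows "\<exists>L p. is_colimit J (CrsGrp sets A) F\<^sub>o F\<^sub>a L p"
proof -
  interpret F: is_functor J "CrsGrp sets A" F\<^sub>o F\<^sub>a by fact
  interpret L: crossed_group A L by fact
  obtain H d e where H: "H \<in> Obj (CrsGrp sets A)" and d: "crossed_hom A H L d"
    and e: "crossed_hom A L H e"
    and ed: "\<And>a x. \<lbrakk>a \<in> Obj A; x \<in> carrier (grp H a)\<rbrakk> \<Longrightarrow> e a (d a x) = x"
    and de: "\<And>a x. \<lbrakk>a \<in> Obj A; x \<in> carrier (grp L a)\<rbrakk> \<Longrightarrow> d a (e a x) = x"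
    using crossed_group_transport[OF L] by blast
  define P where "P i = arrow_of A (F\<^sub>o i) (\<lambda>a x. e a (p i a x)) H" for i
  have P: "P i \<in> arrows (CrsGrp sets A) (F\<^sub>o i) H" if "i \<in> Obj J" for i
    unfolding P_def using F.Obj_map[OF that] H crossed_hom_comp[OF L.category_axioms p[OF that] e]
    by (rule arrow_of_in)
  have mor_P: "mor (P i) a x = e a (p i a x)" if "a \<in> Obj A" "x \<in> carrier (grp (F\<^sub>o i) a)" for i a x
    using that by (simp add: P_def)
  have arrows_J: "u \<in> arrows J (Dom J u) (Cod J u)" if "u \<in> Arr J" for u
    using that by (simp add: arrows_def)
  have "is_cocone J (CrsGrp sets A) F\<^sub>o F\<^sub>a H P"
    unfolding is_cocone_def
  proof (intro conjI ballI H P)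
    fix u assume "u \<in> Arr J"
    then have u: "u \<in> arrows J (Dom J u) (Cod J u)" by (rule arrows_J)
    show "Cmp (CrsGrp sets A) (P (Cod J u)) (F\<^sub>a u) = P (Dom J u)"
      using Cmp_CrsGrp_eq_iff[OF F.Arr_map[OF u] P P] F.J.arrows_Obj[OF u] pF[OF u] mor_P
        crossed_homD(1)[OF arrows_CrsGrpD(3)[OF F.Arr_map[OF u]]] by simp
  qed
  moreover have "\<exists>!h. h \<in> arrows (CrsGrp sets A) H M \<and> (\<forall>i\<in>Obj J. Cmp (CrsGrp sets A) h (P i) = q i)"
    if cocone: "is_cocone J (CrsGrp sets A) F\<^sub>o F\<^sub>a M q" for M q
  proof -
    have M: "M \<in> Obj (CrsGrp sets A)" and q: "\<And>i. i \<in> Obj J \<Longrightarrow> q i \<in> arrows (CrsGrp sets A) (F\<^sub>o i) M"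
      using cocone by (auto simp: is_cocone_def)
    have qF: "mor (q k) a (mor (F\<^sub>a u) a x) = mor (q i) a x"
      if u: "u \<in> arrows J i k" and "a \<in> Obj A" "x \<in> carrier (grp (F\<^sub>o i) a)" for u i k a x
    proof -
      have "Cmp (CrsGrp sets A) (q k) (F\<^sub>a u) = q i"
        using cocone u by (auto simp: is_cocone_def arrows_def)
      then show ?thesis
        using Cmp_CrsGrp_eq_iff[OF F.Arr_map[OF u] q q] F.J.arrows_Obj[OF u] that by blast
    qed
    have Cmp_P: "Cmp (CrsGrp sets A) h (P i) = q i \<longleftrightarrow>
        (\<forall>a\<in>Obj A. \<forall>x\<in>carrier (grp (F\<^sub>o i) a). mor h a (e a (p i a x)) = mor (q i) a x)"
      if "i \<in> Obj J" "h \<in> arrows (CrsGrp sets A) H M" for i h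
      using Cmp_CrsGrp_eq_iff[OF P that(2) q] that mor_P by simp
    obtain h where h: "crossed_hom A L M h"
      and hp: "\<And>i a x. \<lbrakk>i \<in> Obj J; a \<in> Obj A; x \<in> carrier (grp (F\<^sub>o i) a)\<rbrakk> \<Longrightarrow> h a (p i a x) = mor (q i) a x"
      using ex[OF M arrows_CrsGrpD(3)[OF q] qF] by blast
    define h' where "h' = arrow_of A H (\<lambda>a x. h a (d a x)) M"
    have h': "h' \<in> arrows (CrsGrp sets A) H M"
      unfolding h'_def using H M crossed_hom_comp[OF L.category_axioms d h] by (rule arrow_of_in)
    show ?thesis
    proof (rule ex1I[of _ h'])
      show "h' \<in> arrows (CrsGrp sets A) H M \<and> (\<forall>i\<in>Obj J. Cmp (CrsGrp sets A) h' (P i) = q i)"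
        using h' by (simp add: Cmp_P hp h'_def de crossed_homD(1)[OF p] crossed_homD(1)[OF e])
      fix g assume g: "g \<in> arrows (CrsGrp sets A) H M \<and> (\<forall>i\<in>Obj J. Cmp (CrsGrp sets A) g (P i) = q i)"
      then have g_in: "g \<in> arrows (CrsGrp sets A) H M" by blast
      note g_hom = arrows_CrsGrpD(3)[OF g_in]
      have ge: "mor g a (e a x) = h a x" if "a \<in> Obj A" "x \<in> carrier (grp L a)" for a x
      proof (rule unique[OF M crossed_hom_comp[OF L.category_axioms e g_hom] h _ that])
        fix i a x assume *: "i \<in> Obj J" "a \<in> Obj A" "x \<in> carrier (grp (F\<^sub>o i) a)"
        show "mor g a (e a (p i a x)) = h a (p i a x)" using Cmp_P[OF *(1) g_in] g * hp[OF *] by simp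
      qed
      show "g = h'"
      proof (rule arrows_CrsGrp_eqI[OF g_in h'])
        fix a x assume "a \<in> Obj A" "x \<in> carrier (grp H a)"
        then show "mor g a x = mor h' a x"
          using ed ge[OF _ crossed_homD(1)[OF d]] by (simp add: h'_def)
      qed
    qed
  qed
  ultimately show ?thesis unfolding is_colimit_def by blast
qed

text \<open>As the arrows form a small set, the permutation families are few enough for
  \<open>perm_crossed A\<close> to have a copy among the objects. Uniqueness passes to the copy
  because \<open>d\<close> is injective.\<close>

lemma (in size_universe) terminal_crossed_group:
  fixes A :: "('o, 'u) cat"
  assumes "category A" "small (Arr A)"
  obtains T where "T \<in> Obj (CrsGrp sets A)"
    and "\<And>G :: ('o, 'u, 'u) crossed. crossed_group A G \<Longrightarrow> \<exists>f. crossed_hom A G T f"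
    and "\<And>(G :: ('o, 'u, 'u) crossed) f g a x. \<lbrakk>crossed_group A G; crossed_hom A G T f; crossed_hom A G T g; a \<in> Obj A;
      x \<in> carrier (grp G a)\<rbrakk> \<Longrightarrow> f a x = g a x"
proof -
  interpret category A by fact
  have "set_sized sets (carrier (grp (perm_crossed A) a))" for a
    using set_sized_perm_systems[OF assms] by (simp add: perm_crossed_def)
  then obtain T d e where T: "T \<in> Obj (CrsGrp sets A)" "crossed_hom A T (perm_crossed A) d"
    "crossed_hom A (perm_crossed A) T e"
    "\<And>a x. \<lbrakk>a \<in> Obj A; x \<in> carrier (grp T a)\<rbrakk> \<Longrightarrow> e a (d a x) = x"
    using crossed_group_transport[OF crossed_group_perm_crossed] by metis
  show ?thesis
  proof (rule that[OF T(1)])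
    show "\<exists>f. crossed_hom A G T f" if "crossed_group A G" for G :: "('o, 'u, 'u) crossed"
      using crossed_hom_comp[OF category_axioms perm_crossed_terminal_ex[OF that] T(3)] by blast
    fix G :: "('o, 'u, 'u) crossed" and f g a x assume *: "crossed_group A G" "crossed_hom A G T f" "crossed_hom A G T g" "a \<in> Obj A"
      "x \<in> carrier (grp G a)"
    have "d a (f a x) = d a (g a x)"
      using perm_crossed_terminal_unique[OF *(1) crossed_hom_comp[OF category_axioms *(2) T(2)]
          crossed_hom_comp[OF category_axioms *(3) T(2)] *(4,5)] .
    then show "f a x = g a x"
      using T(4)[OF *(4) crossed_homD(1)[OF *(2,4,5)]] T(4)[OF *(4) crossed_homD(1)[OF *(3,4,5)]] by metis
  qed
qed


section \<open>Limits\<close>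

text \<open>
  All components of an element of the limit have to act in the same way, so they lie over one
  element of the terminal crossed group, kept as a further component to cover the empty shape.
\<close>

lemma (in size_universe) small_complete_CrsGrp:
  fixes A :: "('o, 'u) cat"
  assumes A: "category A" "small (Arr A)"
  shows "small_complete small (CrsGrp sets A)"
  unfolding small_complete_def
proof (intro allI impI, elim conjE)
  fix J :: "('u, 'u) cat" and F\<^sub>o F\<^sub>a
  assume "small_category small J" and F: "is_functor J (CrsGrp sets A) F\<^sub>o F\<^sub>a"
  then have J: "small (Obj J)" by (simp add: small_category_def)
  interpret category A by fact
  interpret F: is_functor J "CrsGrp sets A" F\<^sub>o F\<^sub>a by fact
  obtain T where T_Obj: "T \<in> Obj (CrsGrp sets A)"
    and T_ex: "\<And>G :: ('o, 'u, 'u) crossed. crossed_group A G \<Longrightarrow> \<exists>f. crossed_hom A G T f"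
    and T_unique: "\<And>(G :: ('o, 'u, 'u) crossed) f g a x. \<lbrakk>crossed_group A G; crossed_hom A G T f; crossed_hom A G T g; a \<in> Obj A;
      x \<in> carrier (grp G a)\<rbrakk> \<Longrightarrow> f a x = g a x"
    using terminal_crossed_group[OF A] by metis
  interpret T: crossed_group A T using T_Obj by (simp add: Obj_CrsGrp)
  have Fo: "crossed_group A (F\<^sub>o i)" if "i \<in> Obj J" for i
    using F.Obj_map[OF that] by (simp add: Obj_CrsGrp)
  note Fo_in = crossed_group.one_in[OF Fo] crossed_group.mult_in[OF Fo] crossed_group.inv_in[OF Fo]
    crossed_group.res_closed[OF Fo]
  have Fa: "crossed_hom A (F\<^sub>o i) (F\<^sub>o k) (mor (F\<^sub>a u))" if "u \<in> arrows J i k" for u i k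
    using arrows_CrsGrpD(3)[OF F.Arr_map[OF that]] .
  obtain \<tau> where \<tau>: "\<And>i. i \<in> Obj J \<Longrightarrow> crossed_hom A (F\<^sub>o i) T (\<tau> i)"
    using T_ex[OF Fo] by metis
  \<comment> \<open>Since \<open>\<tau> i\<close> preserves action and restriction,
    \<open>\<tau> i a (x i) = t\<close> makes \<open>x i\<close> and all its restrictions act as t
    and its restrictions do.\<close>
  define K where "K a = {(t, x). t \<in> carrier (grp T a) \<and> x \<in> (\<Pi>\<^sub>E i\<in>Obj J. carrier (grp (F\<^sub>o i) a)) \<and>
    (\<forall>i\<in>Obj J. \<tau> i a (x i) = t) \<and> (\<forall>i k. \<forall>u\<in>arrows J i k. mor (F\<^sub>a u) a (x i) = x k)}" for a
  define L where "L = \<lparr>grp = (\<lambda>a. \<lparr>carrier = K a,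
      mult = (\<lambda>v w. (fst v \<otimes>\<^bsub>grp T a\<^esub> fst w, \<lambda>i\<in>Obj J. snd v i \<otimes>\<^bsub>grp (F\<^sub>o i) a\<^esub> snd w i)),
      one = (\<one>\<^bsub>grp T a\<^esub>, \<lambda>i\<in>Obj J. \<one>\<^bsub>grp (F\<^sub>o i) a\<^esub>)\<rparr>),
    res = (\<lambda>\<phi> v. (res T \<phi> (fst v), \<lambda>i\<in>Obj J. res (F\<^sub>o i) \<phi> (snd v i))),
    act = (\<lambda>a b v. act T a b (fst v))\<rparr>"
  have L [simp]: "carrier (grp L a) = K a"
    "v \<otimes>\<^bsub>grp L a\<^esub> w = (fst v \<otimes>\<^bsub>grp T a\<^esub> fst w, \<lambda>i\<in>Obj J. snd v i \<otimes>\<^bsub>grp (F\<^sub>o i) a\<^esub> snd w i)"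
    "\<one>\<^bsub>grp L a\<^esub> = (\<one>\<^bsub>grp T a\<^esub>, \<lambda>i\<in>Obj J. \<one>\<^bsub>grp (F\<^sub>o i) a\<^esub>)"
    "res L \<phi> v = (res T \<phi> (fst v), \<lambda>i\<in>Obj J. res (F\<^sub>o i) \<phi> (snd v i))"
    "act L a b v = act T a b (fst v)" for a b v w \<phi>
    by (simp_all add: L_def)
  have K_iff: "(t, \<lambda>i\<in>Obj J. x i) \<in> K a \<longleftrightarrow> t \<in> carrier (grp T a) \<and>
      (\<forall>i\<in>Obj J. x i \<in> carrier (grp (F\<^sub>o i) a)) \<and> (\<forall>i\<in>Obj J. \<tau> i a (x i) = t) \<and>
      (\<forall>i k. \<forall>u\<in>arrows J i k. mor (F\<^sub>a u) a (x i) = x k)" for t x a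
    using F.J.arrows_Obj by (fastforce simp: K_def PiE_iff)
  have KD: "fst v \<in> carrier (grp T a)" "\<And>i. i \<in> Obj J \<Longrightarrow> snd v i \<in> carrier (grp (F\<^sub>o i) a)"
      "\<And>i. i \<in> Obj J \<Longrightarrow> \<tau> i a (snd v i) = fst v"
      "\<And>i k u. u \<in> arrows J i k \<Longrightarrow> mor (F\<^sub>a u) a (snd v i) = snd v k"
    if "v \<in> K a" for v a
    using that by (auto simp: K_def PiE_iff)
  define p where "p i a v = snd v i" for i and a :: 'o and v :: "'u \<times> ('u \<Rightarrow> 'u)"
  have p: "crossed_hom A L (F\<^sub>o i) (p i)" if i: "i \<in> Obj J" for i
  proof (rule crossed_homI)
    show "act L a b v \<phi> = act (F\<^sub>o i) a b (p i b v) \<phi>"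
      if "\<phi> \<in> arrows A a b" "v \<in> carrier (grp L b)" for a b \<phi> v
      using crossed_homD(4)[OF \<tau>[OF i] that(1)] KD i that by (simp add: p_def)
  qed (use i KD in \<open>auto simp: p_def\<close>)
  have fst_hom: "crossed_hom A L T (\<lambda>_. fst)"
    by (rule crossed_homI) (use KD in auto)
  \<comment> \<open>These maps separate the elements of \<open>L\<close>; the member over
    \<open>T\<close> keeps the family nonempty even if J has no objects.\<close>
  let ?Q = "insert (T, \<lambda>_. fst) ((\<lambda>i. (F\<^sub>o i, p i)) ` Obj J)"
  have L_grp: "crossed_group A L"
  proof (rule crossed_group_jointly_embedded[where Q = ?Q])
    show "crossed_group A M" if "(M, f) \<in> ?Q" for M f
      using that Fo T.crossed_group_axioms by auto
    show "crossed_hom A L M f" if "(M, f) \<in> ?Q" for M f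
      using that p fst_hom by auto
    show "f a \<one>\<^bsub>grp L a\<^esub> = \<one>\<^bsub>grp M a\<^esub>" if "(M, f) \<in> ?Q" "a \<in> Obj A" for M f a
      using that by (auto simp: p_def)
    show "category A" by fact
    fix a assume a: "a \<in> Obj A"
    show "\<one>\<^bsub>grp L a\<^esub> \<in> carrier (grp L a)"
      using a crossed_hom_one[OF Fo T.crossed_group_axioms \<tau>] crossed_hom_one[OF Fo Fo Fa] F.J.arrows_Obj
      by (auto simp: K_iff Fo_in T.one_in)
    fix v assume v: "v \<in> carrier (grp L a)"
    note v' = KD[OF v[unfolded L(1)]]
    have "(inv\<^bsub>grp T a\<^esub> fst v, \<lambda>i\<in>Obj J. inv\<^bsub>grp (F\<^sub>o i) a\<^esub> snd v i) \<in> K a"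
      using a v' crossed_hom_inv[OF Fo T.crossed_group_axioms \<tau> a] crossed_hom_inv[OF Fo Fo Fa a] F.J.arrows_Obj
      by (auto simp: K_iff Fo_in T.inv_in)
    then show "\<exists>w\<in>carrier (grp L a). \<forall>(M, f)\<in>?Q. f a w = inv\<^bsub>grp M a\<^esub> f a v"
      by (rule_tac bexI[of _ "(inv\<^bsub>grp T a\<^esub> fst v, \<lambda>i\<in>Obj J. inv\<^bsub>grp (F\<^sub>o i) a\<^esub> snd v i)"])
        (auto simp: p_def)
    fix w assume w: "w \<in> carrier (grp L a)"
    note w' = KD[OF w[unfolded L(1)]]
    show "v \<otimes>\<^bsub>grp L a\<^esub> w \<in> carrier (grp L a)"
      using a v' w' F.J.arrows_Obj
      by (auto simp: K_iff Fo_in T.mult_in crossed_homD(2)[OF \<tau>] crossed_homD(2)[OF Fa])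
    show "v = w" if "\<And>M f. (M, f) \<in> ?Q \<Longrightarrow> f a v = f a w"
    proof -
      have "fst v = fst w" using that[of T "\<lambda>_. fst"] by simp
      moreover have "snd v = snd w"
        by (rule PiE_ext[of _ "Obj J" "\<lambda>i. carrier (grp (F\<^sub>o i) a)"])
          (use v w that[of "F\<^sub>o _" "p _"] in \<open>auto simp: K_def p_def\<close>)
      ultimately show ?thesis by (simp add: prod_eq_iff)
    qed
  next
    fix a b \<phi> v assume \<phi>: "\<phi> \<in> arrows A a b" and v: "v \<in> carrier (grp L b)"
    note v' = KD[OF v[unfolded L(1)]]
    show "res L \<phi> v \<in> carrier (grp L a)"
      using v' F.J.arrows_Obj crossed_homD(3)[OF \<tau> \<phi>] crossed_homD(3)[OF Fa \<phi>]
      by (auto simp: K_iff Fo_in(4)[OF _ \<phi>] T.res_in[OF \<phi>])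
  next
    fix a b v assume "a \<in> Obj A" "b \<in> Obj A" "v \<in> carrier (grp L b)"
    then show "act L a b v \<in> extensional (arrows A a b)"
      using KD by (simp add: T.act_ext)
  qed simp
  show "\<exists>L p. is_limit J (CrsGrp sets A) F\<^sub>o F\<^sub>a L p"
  proof (rule limit_CrsGrpI[OF F L_grp _ p])
    fix a assume a: "a \<in> Obj A"
    have "set_sized sets (carrier (grp T a) \<times> (\<Pi>\<^sub>E i\<in>Obj J. carrier (grp (F\<^sub>o i) a)))"
      using T_Obj F.Obj_map a
      by (intro set_sized_Times set_sized_PiE set_sized_self J) (auto simp: Obj_CrsGrp)
    then show "set_sized sets (carrier (grp L a))"
      by (rule set_sized_subset) (auto simp: K_def)
  next
    fix u i k a v assume "u \<in> arrows J i k" "a \<in> Obj A" "v \<in> carrier (grp L a)"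
    then show "mor (F\<^sub>a u) a (p i a v) = p k a v" using KD by (simp add: p_def)
  next
    fix M q assume M: "M \<in> Obj (CrsGrp sets A)"
      and q: "\<And>i. i \<in> Obj J \<Longrightarrow> crossed_hom A M (F\<^sub>o i) (q i)"
      and qF: "\<And>u i k a x. \<lbrakk>u \<in> arrows J i k; a \<in> Obj A; x \<in> carrier (grp M a)\<rbrakk>
          \<Longrightarrow> mor (F\<^sub>a u) a (q i a x) = q k a x"
    have M: "crossed_group A M" using M by (simp add: Obj_CrsGrp)
    interpret M: crossed_group A M by fact
    obtain t where t: "crossed_hom A M T t" using T_ex[OF M] by blast
    \<comment> \<open>Maps into \<open>T\<close> are unique, so every leg of the cone induces the
      same t. This puts the tuple into \<open>K a\<close>.\<close>
    have \<tau>q: "\<tau> i a (q i a x) = t a x" if "i \<in> Obj J" "a \<in> Obj A" "x \<in> carrier (grp M a)" for i a x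
      using T_unique[OF M crossed_hom_comp[OF A(1) q \<tau>] t] that by blast
    have "crossed_hom A M L (\<lambda>a x. (t a x, \<lambda>i\<in>Obj J. q i a x))"
    proof (rule crossed_homI)
      fix a b \<phi> x assume \<phi>: "\<phi> \<in> arrows A a b" and x: "x \<in> carrier (grp M b)"
      show "(t a (res M \<phi> x), \<lambda>i\<in>Obj J. q i a (res M \<phi> x)) = res L \<phi> (t b x, \<lambda>i\<in>Obj J. q i b x)"
        using crossed_homD(3)[OF t \<phi> x] crossed_homD(3)[OF q \<phi> x] by (auto cong: restrict_cong)
      show "act M a b x \<phi> = act L a b (t b x, \<lambda>i\<in>Obj J. q i b x) \<phi>"
        using crossed_homD(4)[OF t \<phi> x] by simp
    next
      fix a x assume a: "a \<in> Obj A" and x: "x \<in> carrier (grp M a)"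
      show "(t a x, \<lambda>i\<in>Obj J. q i a x) \<in> carrier (grp L a)"
        using crossed_homD(1)[OF t a x] crossed_homD(1)[OF q a x] \<tau>q[OF _ a x] qF[OF _ a x]
        by (simp add: K_iff)
      fix y assume y: "y \<in> carrier (grp M a)"
      show "(t a (x \<otimes>\<^bsub>grp M a\<^esub> y), \<lambda>i\<in>Obj J. q i a (x \<otimes>\<^bsub>grp M a\<^esub> y)) =
          (t a x, \<lambda>i\<in>Obj J. q i a x) \<otimes>\<^bsub>grp L a\<^esub> (t a y, \<lambda>i\<in>Obj J. q i a y)"
        using crossed_homD(2)[OF t a x y] crossed_homD(2)[OF q a x y] by (auto cong: restrict_cong)
    qed
    then show "\<exists>h. crossed_hom A M L h \<and>
        (\<forall>i\<in>Obj J. \<forall>a\<in>Obj A. \<forall>x\<in>carrier (grp M a). p i a (h a x) = q i a x)"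
      by (intro exI[of _ "\<lambda>a x. (t a x, \<lambda>i\<in>Obj J. q i a x)"]) (simp add: p_def)
  next
    fix M g h a x
    assume M: "M \<in> Obj (CrsGrp sets A)" and g: "crossed_hom A M L g" and h: "crossed_hom A M L h"
      and gh: "\<And>i a x. \<lbrakk>i \<in> Obj J; a \<in> Obj A; x \<in> carrier (grp M a)\<rbrakk> \<Longrightarrow> p i a (g a x) = p i a (h a x)"
      and a: "a \<in> Obj A" and x: "x \<in> carrier (grp M a)"
    have "crossed_group A M" using M by (simp add: Obj_CrsGrp)
    \<comment> \<open>The hypothesis on projections says nothing about this component if J has no
      objects; uniqueness of maps into \<open>T\<close> supplies it.\<close>
    then have "fst (g a x) = fst (h a x)"
      using T_unique[OF _ crossed_hom_comp[OF A(1) g fst_hom] crossed_hom_comp[OF A(1) h fst_hom] a x] by blast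
    moreover have "snd (g a x) = snd (h a x)"
      by (rule PiE_ext[of _ "Obj J" "\<lambda>i. carrier (grp (F\<^sub>o i) a)"])
        (use crossed_homD(1)[OF g a x] crossed_homD(1)[OF h a x] gh[OF _ a x] in \<open>auto simp: K_def p_def\<close>)
    ultimately show "g a x = h a x" by (simp add: prod_eq_iff)
  qed
qed

section \<open>Words and colimits\<close>

text \<open>
  A word stands for the product of its letters in an unspecified crossed group; \<open>word_act\<close> and
  \<open>word_res\<close> compute the action and the restriction that such a product must have.
\<close>

primrec word_act :: "('i \<Rightarrow> ('o, 'm, 'x) crossed) \<Rightarrow> 'o \<Rightarrow> 'o \<Rightarrow> ('i \<times> 'x) list \<Rightarrow> 'm \<Rightarrow> 'm" where
  "word_act F a b [] \<phi> = \<phi>"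
| "word_act F a b (l # w) \<phi> = act (F (fst l)) a b (snd l) (word_act F a b w \<phi>)"

text \<open>This iterates axiom (ii): a letter is restricted along \<phi> as moved by all letters to
  its right, since those act first.\<close>

primrec word_res ::
  "('i \<Rightarrow> ('o, 'm, 'x) crossed) \<Rightarrow> 'o \<Rightarrow> 'o \<Rightarrow> ('i \<times> 'x) list \<Rightarrow> 'm \<Rightarrow> ('i \<times> 'x) list" where
  "word_res F a b [] \<phi> = []"
| "word_res F a b (l # w) \<phi> =
    (fst l, res (F (fst l)) (word_act F a b w \<phi>) (snd l)) # word_res F a b w \<phi>"

primrec word_val ::
  "('o, 'm, 'y) crossed \<Rightarrow> ('i \<Rightarrow> 'o \<Rightarrow> 'x \<Rightarrow> 'y) \<Rightarrow> 'o \<Rightarrow> ('i \<times> 'x) list \<Rightarrow> 'y" where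
  "word_val M q a [] = \<one>\<^bsub>grp M a\<^esub>"
| "word_val M q a (l # w) = q (fst l) a (snd l) \<otimes>\<^bsub>grp M a\<^esub> word_val M q a w"

definition word_inv :: "('i \<Rightarrow> ('o, 'm, 'x) crossed) \<Rightarrow> 'o \<Rightarrow> ('i \<times> 'x) list \<Rightarrow> ('i \<times> 'x) list" where
  "word_inv F a w = rev (map (\<lambda>(i, x). (i, inv\<^bsub>grp (F i) a\<^esub> x)) w)"

definition words :: "('i \<Rightarrow> ('o, 'm, 'x) crossed) \<Rightarrow> 'i set \<Rightarrow> 'o \<Rightarrow> ('i \<times> 'x) list set" where
  "words F I a = lists (SIGMA i:I. carrier (grp (F i) a))"

lemma words_simps [simp]:
  "[] \<in> words F I a"
  "l # w \<in> words F I a \<longleftrightarrow> fst l \<in> I \<and> snd l \<in> carrier (grp (F (fst l)) a) \<and> w \<in> words F I a"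
  "v @ w \<in> words F I a \<longleftrightarrow> v \<in> words F I a \<and> w \<in> words F I a"
  by (cases l; auto simp: words_def)+

section \<open>Words over a family of crossed groups and their values\<close>

locale crossed_family = category A for A :: "('o, 'm) cat" +
  fixes F :: "'i \<Rightarrow> ('o, 'm, 'x) crossed" and I :: "'i set"
  assumes F: "i \<in> I \<Longrightarrow> crossed_group A (F i)"
begin

lemma word_act_in:
  "\<lbrakk>\<phi> \<in> arrows A a b; w \<in> words F I b\<rbrakk> \<Longrightarrow> word_act F a b w \<phi> \<in> arrows A a b"
  by (induction w) (auto simp: crossed_group.act_in[OF F])

lemma word_res_in:
  assumes \<phi>: "\<phi> \<in> arrows A a b" shows "w \<in> words F I b \<Longrightarrow> word_res F a b w \<phi> \<in> words F I a"
proof (induction w)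
  case (Cons l w)
  then show ?case
    using crossed_group.res_closed[OF F word_act_in[OF \<phi>]] by simp
qed simp

lemma word_inv_in: "\<lbrakk>a \<in> Obj A; w \<in> words F I a\<rbrakk> \<Longrightarrow> word_inv F a w \<in> words F I a"
  by (induction w) (auto simp: word_inv_def crossed_group.inv_in[OF F])

end

locale crossed_source = crossed_family A F I + M: crossed_group A M
  for A :: "('o, 'm) cat" and F :: "'i \<Rightarrow> ('o, 'm, 'x) crossed" and I :: "'i set"
    and M :: "('o, 'm, 'y) crossed" +
  fixes q :: "'i \<Rightarrow> 'o \<Rightarrow> 'x \<Rightarrow> 'y"
  assumes q: "i \<in> I \<Longrightarrow> crossed_hom A (F i) M (q i)"
begin

lemma word_val_in: "\<lbrakk>a \<in> Obj A; w \<in> words F I a\<rbrakk> \<Longrightarrow> word_val M q a w \<in> carrier (grp M a)"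
  by (induction w) (simp_all add: M.one_in M.mult_in crossed_homD(1)[OF q])

lemma word_val_append:
  assumes "a \<in> Obj A" "w \<in> words F I a"
  shows "v \<in> words F I a \<Longrightarrow> word_val M q a (v @ w) = word_val M q a v \<otimes>\<^bsub>grp M a\<^esub> word_val M q a w"
proof -
  interpret group "grp M a" using assms(1) by (rule M.group_grp)
  show "v \<in> words F I a \<Longrightarrow> ?thesis"
    by (induction v) (simp_all add: assms word_val_in crossed_homD(1)[OF q] m_assoc)
qed

lemma word_val_inv:
  assumes a: "a \<in> Obj A" shows "w \<in> words F I a \<Longrightarrow>
    word_val M q a (word_inv F a w) = inv\<^bsub>grp M a\<^esub> word_val M q a w"
proof (induction w)
  interpret group "grp M a" using assms(1) by (rule M.group_grp)
  {
    case Nil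
    show ?case by (simp add: word_inv_def)
  next
    case (Cons l w)
    have l: "fst l \<in> I" "snd l \<in> carrier (grp (F (fst l)) a)" and w: "w \<in> words F I a"
      using Cons.prems by simp_all
    note l' = crossed_group.inv_in[OF F[OF l(1)] a l(2)]
    have "word_inv F a (l # w) = word_inv F a w @ [(fst l, inv\<^bsub>grp (F (fst l)) a\<^esub> snd l)]"
      by (simp add: word_inv_def split: prod.split)
    then have "word_val M q a (word_inv F a (l # w)) =
        inv\<^bsub>grp M a\<^esub> word_val M q a w \<otimes>\<^bsub>grp M a\<^esub> inv\<^bsub>grp M a\<^esub> q (fst l) a (snd l)"
      using l l' w a crossed_homD(1)[OF q[OF l(1)] a l(2)]
        crossed_hom_inv[OF F[OF l(1)] M.crossed_group_axioms q[OF l(1)] a l(2)]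
      by (simp add: word_val_append word_inv_in Cons.IH[OF w])
    then show ?case
      using l w a crossed_homD(1)[OF q[OF l(1)] a l(2)] by (simp add: inv_mult_group word_val_in)
  }
qed

text \<open>Each letter acts in \<open>M\<close> as in its own crossed group, so the right-hand side
  does not depend on \<open>M\<close>. Words with equal values in even one target therefore act
  alike.\<close>

lemma act_word_val:
  assumes "\<phi> \<in> arrows A a b"
  shows "w \<in> words F I b \<Longrightarrow> act M a b (word_val M q b w) \<phi> = word_act F a b w \<phi>"
proof (induction w)
  case Nil
  then show ?case using assms by (simp add: M.act_one)
next
  case (Cons l w)
  then show ?case
    using assms arrows_Obj[OF assms]
    by (simp add: M.act_mult[OF assms] word_val_in crossed_homD(1)[OF q]
        crossed_homD(4)[OF q word_act_in[OF assms]])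
qed

text \<open>The restricted value is the value of a word that does not depend on \<open>M\<close>.
  Hence equality of values in all targets is stable under restriction.\<close>

lemma word_val_res:
  assumes "\<phi> \<in> arrows A a b"
  shows "w \<in> words F I b \<Longrightarrow> word_val M q a (word_res F a b w \<phi>) = res M \<phi> (word_val M q b w)"
proof (induction w)
  case Nil
  then show ?case using assms by (simp add: M.res_one)
next
  case (Cons l w)
  then show ?case
    using assms arrows_Obj[OF assms]
    by (simp add: M.res_mult[OF assms] word_val_in crossed_homD(1)[OF q] act_word_val
        crossed_homD(3)[OF q word_act_in[OF assms]])
qed

end

text \<open>
  Elements of the colimit are chosen representatives of classes of words, which keeps the carrier
  within the set of words.
\<close>

lemma (in size_universe) small_cocomplete_CrsGrp:
  fixes A :: "('o, 'u) cat"
  assumes A: "category A" "small (Arr A)"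
  shows "small_cocomplete small (CrsGrp sets A)"
  unfolding small_cocomplete_def
proof (intro allI impI, elim conjE)
  fix J :: "('u, 'u) cat" and F\<^sub>o F\<^sub>a
  assume "small_category small J" and F: "is_functor J (CrsGrp sets A) F\<^sub>o F\<^sub>a"
  then have J: "small (Obj J)" by (simp add: small_category_def)
  interpret category A by fact
  interpret F: is_functor J "CrsGrp sets A" F\<^sub>o F\<^sub>a by fact
  interpret Fo: crossed_family A F\<^sub>o "Obj J"
    by (intro crossed_family.intro crossed_family_axioms.intro)
      (use A F.Obj_map in \<open>simp_all add: Obj_CrsGrp\<close>)
  obtain T where T_Obj: "T \<in> Obj (CrsGrp sets A)"
    and T_ex: "\<And>G :: ('o, 'u, 'u) crossed. crossed_group A G \<Longrightarrow> \<exists>f. crossed_hom A G T f"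
    and T_unique: "\<And>(G :: ('o, 'u, 'u) crossed) f g a x. \<lbrakk>crossed_group A G; crossed_hom A G T f; crossed_hom A G T g; a \<in> Obj A;
      x \<in> carrier (grp G a)\<rbrakk> \<Longrightarrow> f a x = g a x"
    using terminal_crossed_group[OF A] by metis
  have Fa: "crossed_hom A (F\<^sub>o i) (F\<^sub>o k) (mor (F\<^sub>a u))" if "u \<in> arrows J i k" for u i k
    using arrows_CrsGrpD(3)[OF F.Arr_map[OF that]] .
  obtain \<tau> where \<tau>: "\<And>i. i \<in> Obj J \<Longrightarrow> crossed_hom A (F\<^sub>o i) T (\<tau> i)"
    using T_ex[OF Fo.F] by metis
  define Q where "Q = {(M, q). M \<in> Obj (CrsGrp sets A) \<and>
    (\<forall>i\<in>Obj J. crossed_hom A (F\<^sub>o i) M (q i)) \<and>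
    (\<forall>i k a. \<forall>u\<in>arrows J i k. a \<in> Obj A \<longrightarrow>
      (\<forall>x\<in>carrier (grp (F\<^sub>o i) a). q k a (mor (F\<^sub>a u) a x) = q i a x))}"
  have QD: "crossed_source A F\<^sub>o (Obj J) M q"
    "\<And>u i k a x. \<lbrakk>u \<in> arrows J i k; a \<in> Obj A; x \<in> carrier (grp (F\<^sub>o i) a)\<rbrakk>
      \<Longrightarrow> q k a (mor (F\<^sub>a u) a x) = q i a x" if "(M, q) \<in> Q" for M q
    using that Fo.crossed_family_axioms
    by (auto simp: Q_def crossed_source_def crossed_source_axioms_def Obj_CrsGrp)
  \<comment> \<open>Maps into \<open>T\<close> are unique, so the family \<tau> commutes with the
    diagram automatically; in particular some cocone exists.\<close>
  have Q0: "(T, \<tau>) \<in> Q"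
  proof -
    have "\<tau> k a (mor (F\<^sub>a u) a x) = \<tau> i a x"
      if u: "u \<in> arrows J i k" and "a \<in> Obj A" "x \<in> carrier (grp (F\<^sub>o i) a)" for i k a u x
      using T_unique[OF Fo.F crossed_hom_comp[OF A(1) Fa[OF u] \<tau>] \<tau>] that F.J.arrows_Obj[OF u] by blast
    then show ?thesis using T_Obj \<tau> by (auto simp: Q_def)
  qed
  interpret T: crossed_source A F\<^sub>o "Obj J" T \<tau> using Q0 by (rule QD)
  let ?W = "words F\<^sub>o (Obj J)"
  define eqv where "eqv a v w \<longleftrightarrow> (\<forall>(M, q)\<in>Q. word_val M q a v = word_val M q a w)" for a v w
  define rep where "rep a w = (SOME v. v \<in> ?W a \<and> eqv a v w)" for a w
  have rep: "rep a w \<in> ?W a \<and> eqv a (rep a w) w" if "w \<in> ?W a" for a w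
    unfolding rep_def by (rule someI[of _ w]) (use that in \<open>simp add: eqv_def\<close>)
  then have rep_in: "\<And>a w. w \<in> ?W a \<Longrightarrow> rep a w \<in> ?W a"
    and val_rep: "\<And>M q a w. \<lbrakk>(M, q) \<in> Q; w \<in> ?W a\<rbrakk> \<Longrightarrow> word_val M q a (rep a w) = word_val M q a w"
    unfolding eqv_def by fast+
  have rep_eqI: "rep a v = rep a w" if "\<And>M q. (M, q) \<in> Q \<Longrightarrow> word_val M q a v = word_val M q a w" for a v w
  proof -
    \<comment> \<open>Equivalent words present the choice operator with the same predicate, hence
      receive literally the same representative.\<close>
    have "eqv a u v = eqv a u w" for u using that by (auto simp: eqv_def)
    then show ?thesis by (simp add: rep_def)
  qed
  define L where "L = \<lparr>grp = (\<lambda>a. \<lparr>carrier = rep a ` ?W a, mult = (\<lambda>v w. rep a (v @ w)), one = rep a []\<rparr>),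
    res = (\<lambda>\<phi> w. rep (Dom A \<phi>) (word_res F\<^sub>o (Dom A \<phi>) (Cod A \<phi>) w \<phi>)),
    act = (\<lambda>a b w. restrict (word_act F\<^sub>o a b w) (arrows A a b))\<rparr>"
  have L [simp]: "carrier (grp L a) = rep a ` ?W a" "v \<otimes>\<^bsub>grp L a\<^esub> w = rep a (v @ w)"
    "\<one>\<^bsub>grp L a\<^esub> = rep a []" "act L a b w = restrict (word_act F\<^sub>o a b w) (arrows A a b)" for a b v w
    by (simp_all add: L_def)
  have res_L: "res L \<phi> w = rep a (word_res F\<^sub>o a b w \<phi>)" if "\<phi> \<in> arrows A a b" for a b \<phi> w
    using that by (simp add: L_def arrows_def)
  \<comment> \<open>Evaluation serves twice: jointly it embeds \<open>L\<close> into the vertices,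
    which gives the axioms, and singly it is the factorisation of a cocone.\<close>
  have val_hom: "crossed_hom A L M (word_val M q)" if Q: "(M, q) \<in> Q" for M q
  proof -
    interpret crossed_source A F\<^sub>o "Obj J" M q using Q by (rule QD)
    show ?thesis
    proof (rule crossed_homI)
      fix a b \<phi> w assume \<phi>: "\<phi> \<in> arrows A a b" and "w \<in> carrier (grp L b)"
      then have "w \<in> ?W b" using rep_in by auto
      then show "act L a b w \<phi> = act M a b (word_val M q b w) \<phi>"
        using \<phi> by (simp add: act_word_val)
    qed (auto simp: val_rep[OF Q] word_val_in rep_in word_val_append res_L word_val_res Fo.word_res_in)
  qed
  let ?Q = "(\<lambda>(M, q). (M, word_val M q)) ` Q"
  have L_grp: "crossed_group A L"
  proof (rule crossed_group_jointly_embedded[where Q = ?Q])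
    show "?Q \<noteq> {}" using Q0 by blast
    show "crossed_group A M" if "(M, f) \<in> ?Q" for M f
      using that QD(1) by (auto simp: crossed_source_def)
    show "crossed_hom A L M f" if "(M, f) \<in> ?Q" for M f
      using that val_hom by auto
    show "f a \<one>\<^bsub>grp L a\<^esub> = \<one>\<^bsub>grp M a\<^esub>" if "(M, f) \<in> ?Q" "a \<in> Obj A" for M f a
      using that by (auto simp: val_rep)
  next
    fix a v w assume "a \<in> Obj A" and v: "v \<in> carrier (grp L a)" and w: "w \<in> carrier (grp L a)"
      and eq: "\<And>M f. (M, f) \<in> ?Q \<Longrightarrow> f a v = f a w"
    obtain v' w' where *: "v' \<in> ?W a" "v = rep a v'" "w' \<in> ?W a" "w = rep a w'" using v w by auto
    have "word_val M q a v' = word_val M q a w'" if "(M, q) \<in> Q" for M q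
      using eq[of M "word_val M q"] that * val_rep[OF that] by force
    then show "v = w" unfolding *(2,4) by (rule rep_eqI)
  next
    fix a w assume a: "a \<in> Obj A" and "w \<in> carrier (grp L a)"
    then have w: "w \<in> ?W a" using rep_in by auto
    have "word_val M q a (rep a (word_inv F\<^sub>o a w)) = inv\<^bsub>grp M a\<^esub> word_val M q a w"
      if "(M, q) \<in> Q" for M q
      using crossed_source.word_val_inv[OF QD(1)[OF that] a w] val_rep[OF that Fo.word_inv_in[OF a w]] by simp
    then show "\<exists>v\<in>carrier (grp L a). \<forall>(M, f)\<in>?Q. f a v = inv\<^bsub>grp M a\<^esub> f a w"
      using Fo.word_inv_in[OF a w] by (intro bexI[of _ "rep a (word_inv F\<^sub>o a w)"]) auto
  next
    fix a b \<phi> w assume \<phi>: "\<phi> \<in> arrows A a b" and "w \<in> carrier (grp L b)"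
    then have "w \<in> ?W b" using rep_in by auto
    then show "res L \<phi> w \<in> carrier (grp L a)" using Fo.word_res_in[OF \<phi>] by (simp add: res_L[OF \<phi>])
  qed (use A rep_in in auto)
  define p where "p i a x = rep a [(i, x)]" for i a x
  show "\<exists>L p. is_colimit J (CrsGrp sets A) F\<^sub>o F\<^sub>a L p"
  proof (rule colimit_CrsGrpI[OF F L_grp])
    fix a assume "a \<in> Obj A"
    then have "set_sized sets (?W a)"
      unfolding words_def using F.Obj_map
      by (intro set_sized_lists set_sized_Sigma set_sized_self J) (simp add: Obj_CrsGrp)
    then show "set_sized sets (carrier (grp L a))"
      by (rule set_sized_subset) (use rep_in in auto)
  next
    fix i assume i: "i \<in> Obj J"
    show "crossed_hom A (F\<^sub>o i) L (p i)"
    proof (rule crossed_homI)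
      fix a x assume a: "a \<in> Obj A" and x: "x \<in> carrier (grp (F\<^sub>o i) a)"
      show "p i a x \<in> carrier (grp L a)" using i x by (simp add: p_def)
      fix y assume y: "y \<in> carrier (grp (F\<^sub>o i) a)"
      have "rep a [(i, x \<otimes>\<^bsub>grp (F\<^sub>o i) a\<^esub> y)] = rep a (rep a [(i, x)] @ rep a [(i, y)])"
      proof (rule rep_eqI)
        fix M q assume Q: "(M, q) \<in> Q"
        interpret crossed_source A F\<^sub>o "Obj J" M q using Q by (rule QD)
        interpret group "grp M a" using a by (rule M.group_grp)
        show "word_val M q a [(i, x \<otimes>\<^bsub>grp (F\<^sub>o i) a\<^esub> y)] = word_val M q a (rep a [(i, x)] @ rep a [(i, y)])"
          using i a x y by (simp add: word_val_append rep_in val_rep[OF Q] crossed_homD(1,2)[OF q])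
      qed
      then show "p i a (x \<otimes>\<^bsub>grp (F\<^sub>o i) a\<^esub> y) = p i a x \<otimes>\<^bsub>grp L a\<^esub> p i a y" by (simp add: p_def)
    next
      fix a b \<phi> x assume \<phi>: "\<phi> \<in> arrows A a b" and x: "x \<in> carrier (grp (F\<^sub>o i) b)"
      note ab = arrows_Obj[OF \<phi>]
      have "rep a [(i, res (F\<^sub>o i) \<phi> x)] = rep a (word_res F\<^sub>o a b (rep b [(i, x)]) \<phi>)"
      proof (rule rep_eqI)
        fix M q assume Q: "(M, q) \<in> Q"
        interpret crossed_source A F\<^sub>o "Obj J" M q using Q by (rule QD)
        interpret a: group "grp M a" using ab(1) by (rule M.group_grp)
        interpret b: group "grp M b" using ab(2) by (rule M.group_grp)
        show "word_val M q a [(i, res (F\<^sub>o i) \<phi> x)] = word_val M q a (word_res F\<^sub>o a b (rep b [(i, x)]) \<phi>)"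
          using i ab x crossed_homD(3)[OF q \<phi> x] crossed_homD(1)[OF q _ x] M.res_in[OF \<phi>]
          by (simp add: word_val_res[OF \<phi>] rep_in val_rep[OF Q])
      qed
      then show "p i a (res (F\<^sub>o i) \<phi> x) = res L \<phi> (p i b x)" by (simp add: p_def res_L[OF \<phi>])
      \<comment> \<open>The representative of \<open>[(i, x)]\<close> may be another word. Both have
        the same value in \<open>T\<close>, and words with equal values there act alike.\<close>
      have "act L a b (p i b x) \<phi> = act T a b (word_val T \<tau> b [(i, x)]) \<phi>"
        using \<phi> i x T.act_word_val[OF \<phi> rep_in, of "[(i, x)]"] val_rep[OF Q0, of "[(i, x)]" b]
        by (simp add: p_def)
      also have "\<dots> = act (F\<^sub>o i) a b x \<phi>"
        using T.act_word_val[OF \<phi>, of "[(i, x)]"] i x by simp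
      finally show "act (F\<^sub>o i) a b x \<phi> = act L a b (p i b x) \<phi>" by simp
    qed
  next
    fix u i k a x assume *: "u \<in> arrows J i k" "a \<in> Obj A" "x \<in> carrier (grp (F\<^sub>o i) a)"
    show "p k a (mor (F\<^sub>a u) a x) = p i a x"
      unfolding p_def by (rule rep_eqI) (simp add: QD(2)[OF _ *])
  next
    fix M q assume "M \<in> Obj (CrsGrp sets A)" "\<And>i. i \<in> Obj J \<Longrightarrow> crossed_hom A (F\<^sub>o i) M (q i)"
      "\<And>u i k a x. \<lbrakk>u \<in> arrows J i k; a \<in> Obj A; x \<in> carrier (grp (F\<^sub>o i) a)\<rbrakk>
          \<Longrightarrow> q k a (mor (F\<^sub>a u) a x) = q i a x"
    then have Q: "(M, q) \<in> Q" by (auto simp: Q_def)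
    interpret crossed_source A F\<^sub>o "Obj J" M q using Q by (rule QD)
    have "word_val M q a (p i a x) = q i a x"
      if "i \<in> Obj J" "a \<in> Obj A" "x \<in> carrier (grp (F\<^sub>o i) a)" for i a x
    proof -
      interpret group "grp M a" using that(2) by (rule M.group_grp)
      show ?thesis using that crossed_homD(1)[OF q] by (simp add: p_def val_rep[OF Q])
    qed
    then show "\<exists>h. crossed_hom A L M h \<and>
        (\<forall>i\<in>Obj J. \<forall>a\<in>Obj A. \<forall>x\<in>carrier (grp (F\<^sub>o i) a). h a (p i a x) = q i a x)"
      using val_hom[OF Q] by blast
  next
    fix M g h a w
    assume M: "M \<in> Obj (CrsGrp sets A)" and g: "crossed_hom A L M g" and h: "crossed_hom A L M h"
      and gh: "\<And>i a x. \<lbrakk>i \<in> Obj J; a \<in> Obj A; x \<in> carrier (grp (F\<^sub>o i) a)\<rbrakk> \<Longrightarrow> g a (p i a x) = h a (p i a x)"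
      and a: "a \<in> Obj A" and w: "w \<in> carrier (grp L a)"
    have M: "crossed_group A M" using M by (simp add: Obj_CrsGrp)
    \<comment> \<open>The class of a word is the product of the classes of its letters, where g and
      h agree; hence induction on words rather than on elements.\<close>
    have "g a (rep a v) = h a (rep a v)" if "v \<in> ?W a" for v
      using that
    proof (induction v)
      case Nil
      show ?case
        using crossed_hom_one[OF L_grp M g a] crossed_hom_one[OF L_grp M h a] by simp
    next
      case (Cons l v)
      then have l: "fst l \<in> Obj J" "snd l \<in> carrier (grp (F\<^sub>o (fst l)) a)" and v: "v \<in> ?W a" by simp_all
      have "rep a (l # v) = rep a (rep a [l] @ rep a v)"
      proof (rule rep_eqI)
        fix M q assume Q: "(M, q) \<in> Q"
        interpret crossed_source A F\<^sub>o "Obj J" M q using Q by (rule QD)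
        interpret group "grp M a" using a by (rule M.group_grp)
        show "word_val M q a (l # v) = word_val M q a (rep a [l] @ rep a v)"
          using l v a by (simp add: word_val_append rep_in val_rep[OF Q] crossed_homD(1)[OF q])
      qed
      then have *: "rep a (l # v) = p (fst l) a (snd l) \<otimes>\<^bsub>grp L a\<^esub> rep a v" by (simp add: p_def)
      have "p (fst l) a (snd l) \<in> carrier (grp L a)" "rep a v \<in> carrier (grp L a)"
        using l v by (simp_all add: p_def)
      then show ?case
        unfolding * using crossed_homD(2)[OF g a] crossed_homD(2)[OF h a] gh[OF l(1) a l(2)] Cons.IH[OF v]
        by metis
    qed
    then show "g a w = h a w" using w by auto
  qed
qed

theorem corollary2p5:
  fixes small sets :: "'u set \<Rightarrow> bool" and A :: "('u, 'u) cat"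
  assumes "size_universe small sets"
    and "small_category small A"
  shows "small_complete small (CrsGrp sets A) \<and> small_cocomplete small (CrsGrp sets A) \<and>
    (\<exists>T. is_terminal (CrsGrp sets A) T)"
proof -
  interpret size_universe small sets by fact
  have A: "category A" "small (Arr A)" using assms(2) by (simp_all add: small_category_def)
  obtain T where T: "T \<in> Obj (CrsGrp sets A)"
    "\<And>G :: ('u, 'u, 'u) crossed. crossed_group A G \<Longrightarrow> \<exists>f. crossed_hom A G T f"
    and T_unique: "\<And>(G :: ('u, 'u, 'u) crossed) f g a x. \<lbrakk>crossed_group A G; crossed_hom A G T f; crossed_hom A G T g; a \<in> Obj A;
      x \<in> carrier (grp G a)\<rbrakk> \<Longrightarrow> f a x = g a x"
    using terminal_crossed_group[OF A] by metis
  have "\<exists>!h. h \<in> arrows (CrsGrp sets A) G T" if G: "G \<in> Obj (CrsGrp sets A)" for G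
  proof -
    have G': "crossed_group A G" using G by (simp add: Obj_CrsGrp)
    obtain f where "crossed_hom A G T f" using T(2)[OF G'] by blast
    then have "arrow_of A G f T \<in> arrows (CrsGrp sets A) G T" by (rule arrow_of_in[OF G T(1)])
    moreover have "g = h" if "g \<in> arrows (CrsGrp sets A) G T" "h \<in> arrows (CrsGrp sets A) G T" for g h
      using that T_unique[OF G' that[THEN arrows_CrsGrpD(3)]] by (intro arrows_CrsGrp_eqI)
    ultimately show ?thesis by blast
  qed
  then have "is_terminal (CrsGrp sets A) T" using T(1) by (simp add: is_terminal_def)
  then show ?thesis using small_complete_CrsGrp[OF A] small_cocomplete_CrsGrp[OF A] by blast
qed

end
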